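(* Assume $A(x)=A\ge2$ for every $x\in\mathcal X$. Let $\delta\in(0,1)$ and $\iota=\log(3A_{\mathcal X}/\delta)$. Balanced-FTRL with the Shannon regularizer, IX parameters $\gamma_h=\sqrt{A^{H-h}\iota/(2A_{\mathcal X}T)}$ and learning rates $\eta_h=\sqrt{2A^{H-h}\log(A_{\mathcal X})/(A_{\mathcal X}T)}$, run against any (possibly adaptive) opponent sequence, satisfies with probability at least $1-\delta$ $$\mathrm{Reg}^T_{\max}\le\big(5\sqrt{\log(A_{\mathcal X})}+8\iota\big)\sqrt{A_{\mathcal X}T}.$$
   Context: Setting. An episodic two-player zero-sum imperfect-information game with horizon $H\in\mathbb N$ and perfect recall. The max-player's information sets form a finite set $\mathcal X=\bigsqcup_{h=1}^H\mathcal X_h$; each $x\in\mathcal X$ has a finite nonempty action set $\mathcal A(x)$ of size $A(x)$. Perfect recall: each $x_h\in\mathcal X_h$ has a unique history $(x_1,a_1,\dots,x_{h-1},a_{h-1},x_h)$. For $h<H$, $\mathcal X_{h+1}(x_h,a_h)$ is the (nonempty) set of $x_{h+1}\in\mathcal X_{h+1}$ whose history contains $(x_h,a_h)$. Write $x'\ge x$ if $x'=x$ or $x$ appears in the history of $x'$. $\mathcal A(\mathcal X_h)=\{(x_h,a_h):x_h\in\mathcal X_h,a_h\in\mathcal A(x_h)\}$, $A_{\mathcal X}=\sum_{x}A(x)$. A policy $\mu=(\mu_h(\cdot|x_h))$ assigns distributions on $\mathcal A(x_h)$; $\Pi_{\max}$ is the set of policies; realization plan $\mu_{1:h}(x_h,a_h)=\prod_{h'\le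 h}\mu_{h'}(a_{h'}|x_{h'})$ along the history. For a min-player policy $\nu$, $p^\nu_0$ (distribution on $\mathcal X_1$), $p^\nu_h(\cdot|x_h,a_h)$ (distribution on $\mathcal X_{h+1}(x_h,a_h)$) and $r^\nu_h(x_h,a_h)\in[0,1]$ are the induced transitions and expected rewards; $p^\nu_{1:h}(x_h)=p^\nu_0(x_1)\prod_{h'<h}p^\nu_{h'}(x_{h'+1}|x_{h'},a_{h'})$; $\ell^\nu_h(x_h,a_h)=p^\nu_{1:h}(x_h)(1-r^\nu_h(x_h,a_h))$; $\langle\mu_{1:},\ell\rangle=\sum_h\sum_{(x_h,a_h)}\mu_{1:h}(x_h,a_h)\ell_h(x_h,a_h)$. Protocol: $T$ episodes; $\mu^t,\nu^t$ are $\mathcal F_{t-1}$-measurable ($\mathcal F_t$ generated by observations of episodes $\le t$ and $\nu^{t+1}$); in episode $t$ the max-player observes $x^t_h$, plays $a^t_h\sim\mu^t_h(\cdot|x^t_h)$, receives $r^t_h\in[0,1]$, with conditional law $\Pr(x^t_h=x_h,a^t_h=a_h|\mathcal F_{t-1})=p^{\nu^t}_{1:h}(x_h)\mu^t_{1:h}(x_h,a_h)$ and $\mathbb E[\mathbb 1\{x^t_h=x_h,a^t_h=a_h\}(1-r^t_h)|\mathcal F_{t-1}]=\mu^t_{1:h}(x_h,a_h)\ell^{\nu^t}_h(x_h,a_h)$. Regret $\mathrm{Reg}^T_{\max}=\max_{\mu^\dagger}\sum_t\langle\mu^t_{1:}-\mu^\dagger_{1:},\ell^{\nu^t}\rangle$.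 Balanced transitions: $A^\tau(x)=\sum_{x'\ge x}A(x')$, $p^\star_0(x_1)=A^\tau(x_1)/A_{\mathcal X}$, $p^\star_h(x_{h+1}|x_h,a_h)=A^\tau(x_{h+1})/\sum_{x'\in\mathcal X_{h+1}(x_h,a_h)}A^\tau(x')$, $p^\star_{1:h}$ the product along the history. Balanced-FTRL (Shannon) with parameters $\eta_h,\gamma_h>0$: $\tilde\ell^t_h(x_h,a_h)=\mathbb 1\{x^t_h=x_h,a^t_h=a_h\}(1-r^t_h)/(\mu^t_{1:h}(x_h,a_h)+\gamma_h/p^\star_{1:h}(x_h))$, $\tilde L^t=\sum_{k\le t}\tilde\ell^k$, and $\mu^t\in\arg\min_{\mu\in\Pi_{\max}}\langle\mu_{1:},\tilde L^{t-1}\rangle+\sum_{h=1}^H\frac1{\eta_h}\sum_{(x_h,a_h)}w_h\log w_h$ where $w_h(x_h,a_h)=p^\star_{1:h}(x_h)\mu_{1:h}(x_h,a_h)$. *)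

theory Defs
  imports "HOL-Probability.Probability"
begin

text \<open>The max-player's information sets are a finite set X; lvl x is the step h of x;
act x is the action set A(x); par x is the last (information set, action) pair of the
history of x (None iff x is at step 1). The history of x is obtained by iterating par.\<close>

definition efg_tree ::
  "'x set \<Rightarrow> ('x \<Rightarrow> nat) \<Rightarrow> ('x \<Rightarrow> 'a set) \<Rightarrow> ('x \<Rightarrow> ('x \<times> 'a) option) \<Rightarrow> nat \<Rightarrow> bool" where
  "efg_tree X lvl act par H \<longleftrightarrow>
     finite X \<and> X \<noteq> {} \<and> 1 \<le> H \<and>
     (\<forall>x\<in>X. lvl x \<in> {1..H} \<and> finite (act x) \<and> act x \<noteq> {}) \<and>
     (\<forall>x\<in>X. par x = None \<longleftrightarrow> lvl x = 1) \<and>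
     (\<forall>x\<in>X. \<forall>y b. par x = Some (y, b) \<longrightarrow> y \<in> X \<and> b \<in> act y \<and> lvl x = Suc (lvl y)) \<and>
     (\<forall>y\<in>X. \<forall>b\<in>act y. lvl y < H \<longrightarrow> (\<exists>x\<in>X. par x = Some (y, b)))"

text \<open>Product along the history: cprod par r0 st n x = r0 x1 * prod of st x_{h'+1} x_{h'} a_{h'}
(exact whenever the fuel n is at least the depth, e.g. n = H).\<close>
fun cprod :: "('x \<Rightarrow> ('x \<times> 'a) option) \<Rightarrow> ('x \<Rightarrow> real) \<Rightarrow> ('x \<Rightarrow> 'x \<Rightarrow> 'a \<Rightarrow> real)
               \<Rightarrow> nat \<Rightarrow> 'x \<Rightarrow> real" where
  "cprod par r0 st 0 x = r0 x"
| "cprod par r0 st (Suc n) x =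
     (case par x of None \<Rightarrow> r0 x | Some (y, b) \<Rightarrow> st x y b * cprod par r0 st n y)"

fun ancs :: "('x \<Rightarrow> ('x \<times> 'a) option) \<Rightarrow> nat \<Rightarrow> 'x \<Rightarrow> 'x set" where
  "ancs par 0 x = {}"
| "ancs par (Suc n) x = (case par x of None \<Rightarrow> {} | Some (y, b) \<Rightarrow> insert y (ancs par n y))"

definition rplan :: "('x \<Rightarrow> ('x \<times> 'a) option) \<Rightarrow> nat \<Rightarrow> ('x \<Rightarrow> 'a \<Rightarrow> real) \<Rightarrow> 'x \<Rightarrow> 'a \<Rightarrow> real" where
  "rplan par H mu x a = cprod par (\<lambda>_. 1) (\<lambda>_ y b. mu y b) H x * mu x a"

text \<open>Reach probability p_{1:h}(x) from p_0 and transitions P y b x = p_h(x | y, b).\<close>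
definition preach :: "('x \<Rightarrow> ('x \<times> 'a) option) \<Rightarrow> nat \<Rightarrow> ('x \<Rightarrow> real) \<Rightarrow> ('x \<Rightarrow> 'a \<Rightarrow> 'x \<Rightarrow> real)
                      \<Rightarrow> 'x \<Rightarrow> real" where
  "preach par H p0 P x = cprod par p0 (\<lambda>x y b. P y b x) H x"

definition children :: "'x set \<Rightarrow> ('x \<Rightarrow> ('x \<times> 'a) option) \<Rightarrow> 'x \<Rightarrow> 'a \<Rightarrow> 'x set" where
  "children X par y b = {x \<in> X. par x = Some (y, b)}"

definition policies :: "'x set \<Rightarrow> ('x \<Rightarrow> 'a set) \<Rightarrow> ('x \<Rightarrow> 'a \<Rightarrow> real) set" where
  "policies X act = {mu. \<forall>x\<in>X. (\<forall>a\<in>act x. 0 \<le> mu x a) \<and> (\<Sum>a\<in>act x. mu x a) = 1}"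

definition AX :: "'x set \<Rightarrow> ('x \<Rightarrow> 'a set) \<Rightarrow> real" where
  "AX X act = (\<Sum>x\<in>X. real (card (act x)))"

definition Atau :: "'x set \<Rightarrow> ('x \<Rightarrow> 'a set) \<Rightarrow> ('x \<Rightarrow> ('x \<times> 'a) option) \<Rightarrow> nat \<Rightarrow> 'x \<Rightarrow> real" where
  "Atau X act par H x = (\<Sum>x'\<in>{x' \<in> X. x' = x \<or> x \<in> ancs par H x'}. real (card (act x')))"

definition pstar :: "'x set \<Rightarrow> ('x \<Rightarrow> 'a set) \<Rightarrow> ('x \<Rightarrow> ('x \<times> 'a) option) \<Rightarrow> nat \<Rightarrow> 'x \<Rightarrow> real" where
  "pstar X act par H =
     preach par H (\<lambda>x. Atau X act par H x / AX X act)
       (\<lambda>y b x. Atau X act par H x / (\<Sum>x'\<in>children X par y b. Atau X act par H x'))"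

definition ip :: "'x set \<Rightarrow> ('x \<Rightarrow> 'a set) \<Rightarrow> ('x \<Rightarrow> ('x \<times> 'a) option) \<Rightarrow> nat
                  \<Rightarrow> ('x \<Rightarrow> 'a \<Rightarrow> real) \<Rightarrow> ('x \<Rightarrow> 'a \<Rightarrow> real) \<Rightarrow> real" where
  "ip X act par H mu ell = (\<Sum>x\<in>X. \<Sum>a\<in>act x. rplan par H mu x a * ell x a)"

definition lossf :: "('x \<Rightarrow> ('x \<times> 'a) option) \<Rightarrow> nat \<Rightarrow> ('x \<Rightarrow> real) \<Rightarrow> ('x \<Rightarrow> 'a \<Rightarrow> 'x \<Rightarrow> real)
                     \<Rightarrow> ('x \<Rightarrow> 'a \<Rightarrow> real) \<Rightarrow> 'x \<Rightarrow> 'a \<Rightarrow> real" where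
  "lossf par H p0 P r x a = preach par H p0 P x * (1 - r x a)"

text \<open>IX loss estimator of one episode; xo h, ao h, ro h are the observed x_h, a_h, r_h.\<close>
definition ix_est :: "'x set \<Rightarrow> ('x \<Rightarrow> nat) \<Rightarrow> ('x \<Rightarrow> 'a set) \<Rightarrow> ('x \<Rightarrow> ('x \<times> 'a) option) \<Rightarrow> nat
                      \<Rightarrow> (nat \<Rightarrow> real) \<Rightarrow> ('x \<Rightarrow> 'a \<Rightarrow> real)
                      \<Rightarrow> (nat \<Rightarrow> 'x) \<Rightarrow> (nat \<Rightarrow> 'a) \<Rightarrow> (nat \<Rightarrow> real) \<Rightarrow> 'x \<Rightarrow> 'a \<Rightarrow> real" where
  "ix_est X lvl act par H gam mu xo ao ro x a =
     (if xo (lvl x) = x \<and> ao (lvl x) = a then 1 - ro (lvl x) else 0)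
       / (rplan par H mu x a + gam (lvl x) / pstar X act par H x)"

definition ftrl_obj :: "'x set \<Rightarrow> ('x \<Rightarrow> nat) \<Rightarrow> ('x \<Rightarrow> 'a set) \<Rightarrow> ('x \<Rightarrow> ('x \<times> 'a) option) \<Rightarrow> nat
                        \<Rightarrow> (nat \<Rightarrow> real) \<Rightarrow> ('x \<Rightarrow> 'a \<Rightarrow> real) \<Rightarrow> ('x \<Rightarrow> 'a \<Rightarrow> real) \<Rightarrow> real" where
  "ftrl_obj X lvl act par H eta L mu =
     ip X act par H mu L +
     (\<Sum>h\<in>{1..H}. (1 / eta h) *
        (\<Sum>x\<in>{x \<in> X. lvl x = h}. \<Sum>a\<in>act x.
           (let w = pstar X act par H x * rplan par H mu x a in w * ln w)))"

end

theory Submission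
  imports Defs
begin

text \<open>The regret splits into \<open>\<langle>\<mu>\<^sup>t, \<ell>\<^sup>t - est\<^sup>t\<rangle>\<close>, \<open>\<langle>\<mu>\<^sup>t - \<mu>', est\<^sup>t\<rangle>\<close> and \<open>\<langle>\<mu>', est\<^sup>t - \<ell>\<^sup>t\<rangle>\<close>,
  summed over \<open>t\<close>.  The implicit-exploration estimate \<open>est\<close> of a fixed pair \<open>(x, a)\<close> exceeds the loss
  by more than \<open>\<iota> p\<^sup>\<star>(x) / (2 \<gamma>)\<close> with probability at most \<open>exp (- \<iota>)\<close>, because
  \<open>exp (2 \<gamma> (est - \<ell>) / p\<^sup>\<star>(x))\<close> multiplies up to a supermartingale; as \<open>p\<^sup>\<star> \<mu>'\<close> is a probability on each
  level, this controls the third term.  The first term is a bounded martingale plus a bias, the second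
  is the usual entropy penalty plus a stability term, and both the bias and the stability term reduce to
  the sum of \<open>p\<^sup>\<nu>(x) / p\<^sup>\<star>(x)\<close> over the pairs of one level.  Balancedness makes the sum of
  \<open>p\<^sup>\<nu>(x) / p\<^sup>\<star>(x) A\<^sup>\<tau>(x)\<close> over a level nonincreasing in the level and equal to \<open>A\<^sub>X\<close> at the roots, while
  \<open>A\<^sup>\<tau>(x) \<ge> A\<^sup>H\<^sup>-\<^sup>h\<^sup>+\<^sup>1\<close>; so the level sums decay geometrically towards the root, which the choice of
  \<open>\<gamma>\<close> and \<open>\<eta>\<close> turns into a geometric series in \<open>1 / sqrt A\<close>.  If \<open>T \<le> A\<^sub>X\<close> the trivial bound
  \<open>H T\<close> suffices, as \<open>H = O(\<iota>)\<close>.\<close>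

section \<open>The tree of information sets\<close>

locale info_tree =
  fixes X :: "'x set" and lvl :: "'x \<Rightarrow> nat" and act :: "'x \<Rightarrow> 'a set"
    and par :: "'x \<Rightarrow> ('x \<times> 'a) option" and H :: nat
  assumes tree: "efg_tree X lvl act par H"
begin

abbreviation level :: "nat \<Rightarrow> 'x set" where
  "level h \<equiv> {x \<in> X. lvl x = h}"

abbreviation reach :: "('x \<Rightarrow> 'a \<Rightarrow> real) \<Rightarrow> 'x \<Rightarrow> real" where
  "reach \<mu> x \<equiv> cprod par (\<lambda>_. 1) (\<lambda>_ y b. \<mu> y b) H x"

lemma finite_X [simp]: "finite X" and X_nonempty: "X \<noteq> {}" and H_pos: "1 \<le> H"
  using tree unfolding efg_tree_def by blast+

lemma finite_act: "x \<in> X \<Longrightarrow> finite (act x)"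
  and act_nonempty: "x \<in> X \<Longrightarrow> act x \<noteq> {}"
  and lvl_range: "x \<in> X \<Longrightarrow> lvl x \<in> {1..H}"
  using tree unfolding efg_tree_def by blast+

lemma par_None_iff: "x \<in> X \<Longrightarrow> par x = None \<longleftrightarrow> lvl x = 1"
  using tree unfolding efg_tree_def by blast

lemma par_SomeD:
  assumes "x \<in> X" "par x = Some (y, b)"
  shows "y \<in> X" "b \<in> act y" "lvl x = Suc (lvl y)"
  using tree assms unfolding efg_tree_def by blast+

lemma children_nonempty:
  "y \<in> X \<Longrightarrow> b \<in> act y \<Longrightarrow> lvl y < H \<Longrightarrow> children X par y b \<noteq> {}"
  using tree unfolding efg_tree_def children_def by blast

lemma finite_children [simp]: "finite (children X par y b)"
  by (simp add: children_def)

text \<open>The parent of a non-root lies exactly one level below it in \<open>lvl\<close>, so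
  strong induction on \<open>lvl\<close> is induction along histories.\<close>

lemma tree_induct [consumes 1, case_names root child]:
  assumes "x \<in> X"
    and root: "\<And>x. x \<in> X \<Longrightarrow> par x = None \<Longrightarrow> P x"
    and child: "\<And>x y b. x \<in> X \<Longrightarrow> par x = Some (y, b) \<Longrightarrow> y \<in> X \<Longrightarrow> b \<in> act y \<Longrightarrow>
      lvl x = Suc (lvl y) \<Longrightarrow> P y \<Longrightarrow> P x"
  shows "P x"
  using assms(1)
proof (induction "lvl x" arbitrary: x rule: less_induct)
  case less
  show ?case
  proof (cases "par x")
    case None
    then show ?thesis using root less.prems by blast
  next
    case (Some p)
    then obtain y b where p: "par x = Some (y, b)" by (cases p) auto
    note D = par_SomeD[OF less.prems p]
    show ?thesis using child[OF less.prems p D] less.hyps[of y] D by simp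
  qed
qed

text \<open>Each unfolding passes to the parent and roots have level 1, so \<open>lvl x - 1\<close>
  unfoldings reach the root. Once \<open>n\<close> covers them, a further unit of fuel is never
  spent.\<close>

lemma cprod_fuel: "x \<in> X \<Longrightarrow> lvl x \<le> Suc n \<Longrightarrow> cprod par r0 st (Suc n) x = cprod par r0 st n x"
proof (induction n arbitrary: x)
  case 0
  then have "par x = None" using par_None_iff lvl_range by force
  then show ?case by simp
next
  case (Suc n)
  show ?case
  proof (cases "par x")
    case None
    then show ?thesis by simp
  next
    case (Some p)
    then obtain y b where p: "par x = Some (y, b)" by (cases p) auto
    note D = par_SomeD[OF Suc.prems(1) p]
    have "cprod par r0 st (Suc n) y = cprod par r0 st n y"
      using Suc.IH[of y] D Suc.prems by simp
    then show ?thesis 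
      using p cprod.simps(2)[of par r0 st "Suc n" x] cprod.simps(2)[of par r0 st n x]
      by (simp del: cprod.simps)
  qed
qed

lemma ancs_fuel: "x \<in> X \<Longrightarrow> lvl x \<le> Suc n \<Longrightarrow> ancs par (Suc n) x = ancs par n x"
proof (induction n arbitrary: x)
  case 0
  then have "par x = None" using par_None_iff lvl_range by force
  then show ?case by simp
next
  case (Suc n)
  show ?case
  proof (cases "par x")
    case None
    then show ?thesis by simp
  next
    case (Some p)
    then obtain y b where p: "par x = Some (y, b)" by (cases p) auto
    note D = par_SomeD[OF Suc.prems(1) p]
    have "ancs par (Suc n) y = ancs par n y"
      using Suc.IH[of y] D Suc.prems by simp
    then show ?thesis 
      using p ancs.simps(2)[of par "Suc n" x] ancs.simps(2)[of par n x]
      by (simp del: ancs.simps)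
  qed
qed

lemma cprod_root: "par x = None \<Longrightarrow> cprod par r0 st n x = r0 x"
  by (cases n) auto

text \<open>Adding one unit of idle fuel and spending it leaves the same fuel \<open>H\<close> on
  both sides. This is the recursion along histories that later proofs use instead of
  \<open>cprod.simps\<close>.\<close>

lemma cprod_child:
  assumes "x \<in> X" "par x = Some (y, b)"
  shows "cprod par r0 st H x = st x y b * cprod par r0 st H y"
proof -
  have "cprod par r0 st H x = cprod par r0 st (Suc H) x"
    using cprod_fuel[OF assms(1), of H] lvl_range[OF assms(1)] by simp
  then show ?thesis using assms(2) by simp
qed

lemma ancs_root: "par x = None \<Longrightarrow> ancs par n x = {}"
  by (cases n) auto

lemma ancs_child:
  assumes "x \<in> X" "par x = Some (y, b)"
  shows "ancs par H x = insert y (ancs par H y)"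
proof -
  have "ancs par H x = ancs par (Suc H) x"
    using ancs_fuel[OF assms(1), of H] lvl_range[OF assms(1)] by simp
  then show ?thesis using assms(2) by simp
qed

lemma sum_children:
  assumes "y \<in> X"
  shows "(\<Sum>b\<in>act y. \<Sum>x\<in>children X par y b. f x) = (\<Sum>x\<in>(\<Union>b\<in>act y. children X par y b). f x)"
  by (rule sum.UNION_disjoint[symmetric]) (use finite_act[OF assms] in \<open>auto simp: children_def\<close>)

text \<open>A set above level 1 has exactly one parent pair, so the families
  \<open>children X par y b\<close> over the pairs of level \<open>h\<close> partition the next
  level.\<close>

lemma sum_level_Suc:
  assumes "1 \<le> h"
  shows "(\<Sum>x\<in>level (Suc h). f x) = (\<Sum>y\<in>level h. \<Sum>b\<in>act y. \<Sum>x\<in>children X par y b. f x)"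
proof -
  have eq: "level (Suc h) = (\<Union>y\<in>level h. \<Union>b\<in>act y. children X par y b)"
  proof (intro equalityI subsetI)
    fix x assume x: "x \<in> level (Suc h)"
    then have "par x \<noteq> None" using par_None_iff assms by auto
    then obtain y b where p: "par x = Some (y, b)" by (cases "par x") auto
    with x par_SomeD[of x y b] show "x \<in> (\<Union>y\<in>level h. \<Union>b\<in>act y. children X par y b)"
      by (auto simp: children_def)
  qed (auto simp: children_def dest: par_SomeD)
  have "(\<Sum>x\<in>level (Suc h). f x) = (\<Sum>y\<in>level h. \<Sum>x\<in>(\<Union>b\<in>act y. children X par y b). f x)"
    unfolding eq by (rule sum.UNION_disjoint) (auto simp: children_def finite_act)
  also have "\<dots> = (\<Sum>y\<in>level h. \<Sum>b\<in>act y. \<Sum>x\<in>children X par y b. f x)"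
    by (intro sum.cong refl sum_children[symmetric]) auto
  finally show ?thesis .
qed

lemma sum_levels: "(\<Sum>x\<in>X. f x) = (\<Sum>h\<in>{1..H}. \<Sum>x\<in>level h. f x)"
proof -
  have "(\<Sum>x\<in>X. f x) = sum f (\<Union>h\<in>{1..H}. level h)"
    by (rule sum.cong) (use lvl_range in auto)
  also have "\<dots> = (\<Sum>h\<in>{1..H}. \<Sum>x\<in>level h. f x)"
    by (rule sum.UNION_disjoint) auto
  finally show ?thesis .
qed

section \<open>Policies and transitions\<close>

lemma policiesD:
  assumes "\<mu> \<in> policies X act" "x \<in> X"
  shows "a \<in> act x \<Longrightarrow> 0 \<le> \<mu> x a" "(\<Sum>a\<in>act x. \<mu> x a) = 1"
  using assms by (auto simp: policies_def)

lemma policies_nonempty: "policies X act \<noteq> {}"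
proof -
  have "(\<lambda>x a. 1 / real (card (act x))) \<in> policies X act"
    unfolding policies_def using finite_act act_nonempty by (auto simp: card_eq_0_iff)
  then show ?thesis by blast
qed

lemma reach_nonneg:
  assumes "\<mu> \<in> policies X act"
  shows "x \<in> X \<Longrightarrow> 0 \<le> reach \<mu> x"
proof (induction x rule: tree_induct)
  case (root x)
  then show ?case by (simp add: cprod_root)
next
  case (child x y b)
  then show ?case using assms by (simp add: cprod_child policiesD)
qed

lemma rplan_nonneg: "\<mu> \<in> policies X act \<Longrightarrow> x \<in> X \<Longrightarrow> a \<in> act x \<Longrightarrow> 0 \<le> rplan par H \<mu> x a"
  by (simp add: rplan_def reach_nonneg policiesD)

text \<open>The opponent's kernels and the balanced ones both satisfy this predicate, so one
  conservation-of-mass argument serves the two.\<close>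

definition transition :: "('x \<Rightarrow> real) \<Rightarrow> ('x \<Rightarrow> 'a \<Rightarrow> 'x \<Rightarrow> real) \<Rightarrow> bool" where
  "transition p0 P \<longleftrightarrow>
     (\<forall>x\<in>level 1. 0 \<le> p0 x) \<and> (\<Sum>x\<in>level 1. p0 x) = 1 \<and>
     (\<forall>y\<in>X. \<forall>b\<in>act y. lvl y < H \<longrightarrow>
        (\<forall>x\<in>children X par y b. 0 \<le> P y b x) \<and> (\<Sum>x\<in>children X par y b. P y b x) = 1)"

lemma preach_root: "par x = None \<Longrightarrow> preach par H p0 P x = p0 x"
  by (simp add: preach_def cprod_root)

lemma preach_child:
  "x \<in> X \<Longrightarrow> par x = Some (y, b) \<Longrightarrow> preach par H p0 P x = P y b x * preach par H p0 P y"
  by (simp add: preach_def cprod_child)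

lemma lvl_parent_less: "x \<in> X \<Longrightarrow> par x = Some (y, b) \<Longrightarrow> lvl y < H"
  using par_SomeD[of x y b] lvl_range[of x] by auto

lemma preach_nonneg:
  assumes "transition p0 P" "x \<in> X"
  shows "0 \<le> preach par H p0 P x"
  using assms(2)
proof (induction x rule: tree_induct)
  case (root x)
  then show ?case using assms(1) par_None_iff by (simp add: preach_root transition_def)
next
  case (child x y b)
  have "0 \<le> P y b x"
    using assms(1) child lvl_parent_less[of x y b] unfolding transition_def children_def by blast
  then show ?case using child by (simp add: preach_child)
qed

text \<open>The summand is the probability of visiting \<open>x\<close> when \<open>\<mu>\<close>
  plays against \<open>P\<close>. Descending one level first distributes this mass over the actions
  and then over the children, and both distributions have total mass one.\<close>

lemma sum_preach_reach:
  assumes tr: "transition p0 P" and mu: "\<mu> \<in> policies X act"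
  shows "1 \<le> h \<Longrightarrow> h \<le> H \<Longrightarrow> (\<Sum>x\<in>level h. preach par H p0 P x * reach \<mu> x) = 1"
proof (induction h rule: dec_induct)
  case base
  have "(\<Sum>x\<in>level 1. preach par H p0 P x * reach \<mu> x) = (\<Sum>x\<in>level 1. p0 x)"
    by (rule sum.cong) (auto simp: par_None_iff preach_root cprod_root)
  then show ?case using tr by (simp add: transition_def)
next
  case (step h)
  have "(\<Sum>x\<in>level (Suc h). preach par H p0 P x * reach \<mu> x)
      = (\<Sum>y\<in>level h. \<Sum>b\<in>act y. \<Sum>x\<in>children X par y b. preach par H p0 P x * reach \<mu> x)"
    by (rule sum_level_Suc) (use step in simp)
  also have "\<dots> = (\<Sum>y\<in>level h. \<Sum>b\<in>act y. preach par H p0 P y * reach \<mu> y * \<mu> y b)"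
  proof (intro sum.cong refl)
    fix y b assume y: "y \<in> level h" and b: "b \<in> act y"
    have "(\<Sum>x\<in>children X par y b. preach par H p0 P x * reach \<mu> x)
      = (\<Sum>x\<in>children X par y b. P y b x * (preach par H p0 P y * reach \<mu> y * \<mu> y b))"
      by (rule sum.cong) (auto simp: children_def preach_child cprod_child)
    also have "\<dots> = (\<Sum>x\<in>children X par y b. P y b x) * (preach par H p0 P y * reach \<mu> y * \<mu> y b)"
      by (simp add: sum_distrib_right)
    also have "(\<Sum>x\<in>children X par y b. P y b x) = 1"
      using tr y b step by (auto simp: transition_def)
    finally show "(\<Sum>x\<in>children X par y b. preach par H p0 P x * reach \<mu> x)
      = preach par H p0 P y * reach \<mu> y * \<mu> y b" by simp
  qed
  also have "\<dots> = (\<Sum>y\<in>level h. preach par H p0 P y * reach \<mu> y)"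
    by (intro sum.cong refl) (use mu in \<open>auto simp: policiesD simp flip: sum_distrib_left\<close>)
  finally show ?case using step by simp
qed

lemma sum_preach_rplan:
  assumes "transition p0 P" "\<mu> \<in> policies X act" "h \<in> {1..H}"
  shows "(\<Sum>x\<in>level h. \<Sum>a\<in>act x. preach par H p0 P x * rplan par H \<mu> x a) = 1"
proof -
  have "(\<Sum>x\<in>level h. \<Sum>a\<in>act x. preach par H p0 P x * rplan par H \<mu> x a)
     = (\<Sum>x\<in>level h. preach par H p0 P x * reach \<mu> x)"
    by (intro sum.cong refl)
       (use assms(2) in \<open>auto simp: rplan_def policiesD simp flip: sum_distrib_left\<close>)
  then show ?thesis using sum_preach_reach[OF assms(1,2)] assms(3) by simp
qed

section \<open>The balanced transitions\<close>

abbreviation up :: "'x \<Rightarrow> 'x set" where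
  "up x \<equiv> insert x (ancs par H x)"

lemma up_child: "x \<in> X \<Longrightarrow> par x = Some (y, b) \<Longrightarrow> up x = insert x (up y)"
  by (simp add: ancs_child)

text \<open>A history meets every level up to its own exactly once. Perfect recall enters the
  counting of subtree sizes in this form.\<close>

lemma bij_betw_lvl_up: "x \<in> X \<Longrightarrow> bij_betw lvl (up x) {1..lvl x} \<and> up x \<subseteq> X"
proof (induction x rule: tree_induct)
  case (root x)
  then have "lvl x = 1" "up x = {x}" using par_None_iff[of x] by (simp_all add: ancs_root)
  then show ?case using root by (simp only:) (simp add: bij_betw_def)
next
  case (child x y b)
  have 1: "lvl x \<notin> {1..lvl y}" using child by simp
  then have 2: "x \<notin> up y" using child(6) by (auto dest: bij_betwE)
  have "{1..lvl y} \<union> {lvl x} = {1..lvl x}" using child(5) by auto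
  then have "bij_betw lvl (up y \<union> {x}) {1..lvl x}"
    using notIn_Un_bij_betw[of x "up y" lvl "{1..lvl y}"] 1 2 child(6) by simp
  moreover have "up x = up y \<union> {x}" using up_child[OF child(1,2)] by auto
  ultimately show ?case using child by (simp only:) auto
qed

lemma up_parent: "x \<in> X \<Longrightarrow> z \<in> up x \<Longrightarrow> par z = Some (y, b) \<Longrightarrow> y \<in> up x"
proof (induction x rule: tree_induct)
  case (root x)
  then show ?case by (simp add: ancs_root)
next
  case (child x y' b')
  note up = up_child[OF child.hyps(1,2)]
  show ?case
  proof (cases "z = x")
    case True
    then show ?thesis using up child.hyps(2) child.prems(2) by simp
  next
    case False
    then have "z \<in> up y'" using up child.prems(1) by simp
    then have "y \<in> up y'" using child.IH child.prems(2) by simp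
    then show ?thesis unfolding up by simp
  qed
qed

lemma Atau_alt:
  "Atau X act par H x = (\<Sum>x'\<in>X. if x \<in> up x' then real (card (act x')) else 0)"
  unfolding Atau_def by (subst sum.inter_filter) (auto intro!: sum.cong)

lemma Atau_ge_card: "x \<in> X \<Longrightarrow> real (card (act x)) \<le> Atau X act par H x"
  unfolding Atau_def by (rule member_le_sum) auto

lemma card_act_pos: "x \<in> X \<Longrightarrow> 0 < card (act x)"
  using finite_act act_nonempty by (simp add: card_gt_0_iff)

lemma Atau_pos: "x \<in> X \<Longrightarrow> 0 < Atau X act par H x"
  using Atau_ge_card card_act_pos by (metis less_le_trans of_nat_0_less_iff)

text \<open>Double counting: the actions of \<open>x'\<close> are counted once for every element of
  \<open>C\<close> on the history of \<open>x'\<close>. If \<open>C\<close> lies in a single level,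
  that number is 0 or 1.\<close>

lemma sum_Atau:
  assumes "C \<subseteq> X"
  shows "(\<Sum>x\<in>C. Atau X act par H x) = (\<Sum>x'\<in>X. real (card (act x')) * real (card (C \<inter> up x')))"
proof -
  have fin: "finite C" using assms finite_X by (rule finite_subset)
  have "(\<Sum>x\<in>C. Atau X act par H x) =
     (\<Sum>x'\<in>X. \<Sum>x\<in>C. if x \<in> up x' then real (card (act x')) else 0)"
    unfolding Atau_alt by (rule sum.swap)
  also have "\<dots> = (\<Sum>x'\<in>X. real (card (act x')) * real (card (C \<inter> up x')))"
  proof (rule sum.cong)
    fix x'
    have "(\<Sum>x\<in>C. if x \<in> up x' then real (card (act x')) else 0)
       = (\<Sum>x\<in>C \<inter> up x'. real (card (act x')))"
      using sum.inter_restrict[OF fin, of "\<lambda>_. real (card (act x'))" "up x'"] by simp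
    then show "(\<Sum>x\<in>C. if x \<in> up x' then real (card (act x')) else 0)
       = real (card (act x')) * real (card (C \<inter> up x'))" by simp
  qed simp
  finally show ?thesis .
qed

lemma sum_Atau_roots: "(\<Sum>x\<in>level 1. Atau X act par H x) = AX X act"
proof -
  have "card (level 1 \<inter> up x') = 1" if "x' \<in> X" for x'
  proof -
    note b = bij_betw_lvl_up[OF that]
    have "1 \<in> {1..lvl x'}" using lvl_range[OF that] by simp
    then obtain z where z: "z \<in> up x'" "lvl z = 1" using b unfolding bij_betw_def by (metis imageE)
    have "level 1 \<inter> up x' = {z}"
    proof (intro equalityI subsetI)
      fix u assume "u \<in> level 1 \<inter> up x'"
      then have "u = z" using z b inj_onD[of lvl "up x'" u z] unfolding bij_betw_def by auto
      then show "u \<in> {z}" by simp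
    qed (use z b in blast)
    then show ?thesis by simp
  qed
  then show ?thesis by (subst sum_Atau) (auto simp: AX_def)
qed

text \<open>A history through a child of \<open>y\<close> passes through \<open>y\<close>, and
  through only one such child because they all share a level. The actions at \<open>y\<close> itself
  are counted only on the right.\<close>

lemma sum_Atau_children:
  assumes y: "y \<in> X"
  shows "(\<Sum>b\<in>act y. \<Sum>x\<in>children X par y b. Atau X act par H x) \<le> Atau X act par H y"
proof -
  let ?C = "\<Union>b\<in>act y. children X par y b"
  have C: "?C \<subseteq> X" by (auto simp: children_def)
  have lvlC: "lvl x = Suc (lvl y)" if "x \<in> ?C" for x
    using that par_SomeD by (auto simp: children_def)
  have "(\<Sum>b\<in>act y. \<Sum>x\<in>children X par y b. Atau X act par H x)
     = (\<Sum>x'\<in>X. real (card (act x')) * real (card (?C \<inter> up x')))"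
    by (simp only: sum_children[OF y] sum_Atau[OF C])
  also have "\<dots> \<le> (\<Sum>x'\<in>X. if y \<in> up x' then real (card (act x')) else 0)"
  proof (rule sum_mono)
    fix x' assume x': "x' \<in> X"
    have inj: "inj_on lvl (up x')" using bij_betw_lvl_up[OF x'] by (simp add: bij_betw_def)
    show "real (card (act x')) * real (card (?C \<inter> up x')) \<le> (if y \<in> up x' then real (card (act x')) else 0)"
    proof (cases "?C \<inter> up x' = {}")
      case True
      then show ?thesis by (simp only: card.empty) auto
    next
      case False
      then obtain z where z: "z \<in> ?C" "z \<in> up x'" by blast
      from z(1) obtain b where "par z = Some (y, b)" unfolding children_def by blast
      then have "y \<in> up x'" using up_parent[OF x' z(2)] by blast
      moreover have "?C \<inter> up x' = {z}"
      proof (intro equalityI subsetI)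
        fix u assume u: "u \<in> ?C \<inter> up x'"
        then have "lvl u = lvl z" using lvlC[of u] lvlC[OF z(1)] by simp
        then have "u = z" using inj_onD[OF inj] u z(2) by blast
        then show "u \<in> {z}" by simp
      qed (use z in blast)
      ultimately show ?thesis by simp
    qed
  qed
  finally show ?thesis by (simp add: Atau_alt)
qed

lemma AX_pos: "0 < AX X act"
  unfolding AX_def using X_nonempty card_act_pos by (intro sum_pos) auto

text \<open>Below level \<open>H\<close> every pair has a child, so the normalising sums are
  positive and the quotients are genuine distributions.\<close>

lemma transition_balanced:
  "transition (\<lambda>x. Atau X act par H x / AX X act)
     (\<lambda>y b x. Atau X act par H x / (\<Sum>x'\<in>children X par y b. Atau X act par H x'))"
proof -
  have S: "(\<Sum>x'\<in>children X par y b. Atau X act par H x') > 0"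
    if "y \<in> X" "b \<in> act y" "lvl y < H" for y b
    using children_nonempty[OF that] by (intro sum_pos) (auto simp: children_def Atau_pos)
  show ?thesis
    unfolding transition_def
  proof (intro conjI ballI impI)
    show "(\<Sum>x\<in>level 1. Atau X act par H x / AX X act) = 1"
      using AX_pos sum_Atau_roots by (simp flip: sum_divide_distrib)
    show "0 \<le> Atau X act par H x / AX X act" if "x \<in> level 1" for x
      using that AX_pos Atau_pos[of x] by simp
  next
    fix y b assume yb: "y \<in> X" "b \<in> act y" "lvl y < H"
    show "(\<Sum>x\<in>children X par y b.
        Atau X act par H x / (\<Sum>x'\<in>children X par y b. Atau X act par H x')) = 1"
      using S[OF yb] by (simp flip: sum_divide_distrib)
    show "0 \<le> Atau X act par H x / (\<Sum>x'\<in>children X par y b. Atau X act par H x')"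
      if "x \<in> children X par y b" for x
      using S[OF yb] Atau_pos[of x] that by (simp add: children_def)
  qed
qed

lemma sum_pstar_rplan:
  assumes "\<mu> \<in> policies X act" "h \<in> {1..H}"
  shows "(\<Sum>x\<in>level h. \<Sum>a\<in>act x. pstar X act par H x * rplan par H \<mu> x a) = 1"
  unfolding pstar_def by (rule sum_preach_rplan[OF transition_balanced assms])

lemma pstar_root:
  "par x = None \<Longrightarrow> pstar X act par H x = Atau X act par H x / AX X act"
  by (simp add: pstar_def preach_root)

lemma pstar_child:
  "x \<in> X \<Longrightarrow> par x = Some (y, b) \<Longrightarrow> pstar X act par H x =
    Atau X act par H x / (\<Sum>x'\<in>children X par y b. Atau X act par H x') * pstar X act par H y"
  by (simp add: pstar_def preach_child)

lemma pstar_pos: "x \<in> X \<Longrightarrow> 0 < pstar X act par H x"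
proof (induction x rule: tree_induct)
  case (root x)
  then show ?case by (simp add: pstar_root Atau_pos AX_pos)
next
  case (child x y b)
  have "(\<Sum>x'\<in>children X par y b. Atau X act par H x') > 0"
    using child by (intro sum_pos) (auto simp: children_def Atau_pos)
  then show ?case using child by (simp add: pstar_child Atau_pos)
qed

text \<open>Passing from \<open>y\<close> to a child multiplies the ratio of reach probabilities by
  \<open>P y b x\<close> times the normaliser over \<open>Atau x\<close>. The weight
  \<open>Atau x\<close> cancels, \<open>P\<close> sums to one, and what remains is the normaliser,
  whose sum over the actions is at most \<open>Atau y\<close> by
  \<open>sum_Atau_children\<close>.\<close>

lemma sum_preach_Atau_pstar:
  assumes tr: "transition p0 P"
  shows "1 \<le> h \<Longrightarrow> h \<le> H \<Longrightarrow>
    (\<Sum>x\<in>level h. preach par H p0 P x / pstar X act par H x * Atau X act par H x) \<le> AX X act"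
proof (induction h rule: dec_induct)
  case base
  have "(\<Sum>x\<in>level 1. preach par H p0 P x / pstar X act par H x * Atau X act par H x)
     = (\<Sum>x\<in>level 1. p0 x * AX X act)"
  proof (rule sum.cong)
    fix x assume "x \<in> level 1"
    then show "preach par H p0 P x / pstar X act par H x * Atau X act par H x = p0 x * AX X act"
      using Atau_pos[of x] AX_pos by (auto simp: par_None_iff preach_root pstar_root)
  qed simp
  also have "\<dots> = AX X act"
    using tr by (simp add: transition_def flip: sum_distrib_right)
  finally show ?case by simp
next
  case (step h)
  let ?q = "\<lambda>x. preach par H p0 P x / pstar X act par H x"
  let ?S = "\<lambda>y b. \<Sum>x\<in>children X par y b. Atau X act par H x"
  have "(\<Sum>x\<in>level (Suc h). ?q x * Atau X act par H x)
      = (\<Sum>y\<in>level h. \<Sum>b\<in>act y. \<Sum>x\<in>children X par y b. ?q x * Atau X act par H x)"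
    by (rule sum_level_Suc) (use step in simp)
  also have "\<dots> = (\<Sum>y\<in>level h. \<Sum>b\<in>act y. ?q y * ?S y b)"
  proof (intro sum.cong refl)
    fix y b assume y: "y \<in> level h" and b: "b \<in> act y"
    have "(\<Sum>x\<in>children X par y b. ?q x * Atau X act par H x)
      = (\<Sum>x\<in>children X par y b. P y b x * (?q y * ?S y b))"
    proof (rule sum.cong)
      fix x assume x: "x \<in> children X par y b"
      then have "?S y b > 0" by (intro sum_pos) (auto simp: children_def Atau_pos)
      moreover have "pstar X act par H y > 0" using pstar_pos y by simp
      ultimately show "?q x * Atau X act par H x = P y b x * (?q y * ?S y b)"
        using x Atau_pos[of x] by (auto simp: children_def preach_child pstar_child)
    qed simp
    also have "\<dots> = (\<Sum>x\<in>children X par y b. P y b x) * (?q y * ?S y b)"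
      by (rule sum_distrib_right[symmetric])
    also have "(\<Sum>x\<in>children X par y b. P y b x) = 1"
      using tr y b step by (auto simp: transition_def)
    finally show "(\<Sum>x\<in>children X par y b. ?q x * Atau X act par H x) = ?q y * ?S y b" by simp
  qed
  also have "\<dots> = (\<Sum>y\<in>level h. ?q y * (\<Sum>b\<in>act y. ?S y b))"
    by (simp add: sum_distrib_left)
  also have "\<dots> \<le> (\<Sum>y\<in>level h. ?q y * Atau X act par H y)"
    using sum_Atau_children pstar_pos preach_nonneg[OF tr]
    by (intro sum_mono mult_left_mono) (auto simp: less_imp_le)
  also have "\<dots> \<le> AX X act" using step by simp
  finally show ?case .
qed

text \<open>By induction from the last level upwards: each of the \<open>A\<close> actions leads to
  at least one child with its own full subtree. The extra \<open>Suc\<close> is there because a set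
  at level \<open>H\<close> already has \<open>A\<close> actions.\<close>

lemma Atau_ge_power:
  assumes A: "\<forall>x\<in>X. card (act x) = A"
  shows "x \<in> X \<Longrightarrow> real A ^ (Suc (H - lvl x)) \<le> Atau X act par H x"
proof (induction "H - lvl x" arbitrary: x)
  case 0
  then show ?case using Atau_ge_card[of x] A by auto
next
  case (Suc n)
  have "real A ^ Suc (H - lvl x) = (\<Sum>b\<in>act x. real A ^ (Suc n))"
    using Suc A by simp
  also have "\<dots> \<le> (\<Sum>b\<in>act x. \<Sum>x'\<in>children X par x b. Atau X act par H x')"
  proof (rule sum_mono)
    fix b assume b: "b \<in> act x"
    then obtain z where z: "z \<in> children X par x b" using children_nonempty[of x b] Suc by force
    then have "z \<in> X" "lvl z = Suc (lvl x)" using par_SomeD by (auto simp: children_def)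
    moreover from this have "n = H - lvl z" using Suc(2) by simp
    ultimately have "real A ^ Suc n \<le> Atau X act par H z" using Suc(1)[of z] by simp
    also have "\<dots> \<le> (\<Sum>x'\<in>children X par x b. Atau X act par H x')"
      using z Atau_pos by (intro member_le_sum) (auto simp: children_def less_imp_le)
    finally show "real A ^ Suc n \<le> \<dots>" .
  qed
  also have "\<dots> \<le> Atau X act par H x" by (rule sum_Atau_children[OF Suc(3)])
  finally show ?case .
qed

text \<open>The subtree below any root already has this many actions. The lemma makes
  \<open>H\<close> logarithmic in the size of the game.\<close>

lemma AX_ge_power:
  assumes A: "\<forall>x\<in>X. card (act x) = A"
  shows "real A ^ H \<le> AX X act"
proof -
  obtain x where x: "x \<in> X" using X_nonempty by blast
  then have "1 \<in> lvl ` up x" using bij_betw_lvl_up[OF x] lvl_range[OF x] by (simp add: bij_betw_def)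
  then obtain z where z: "z \<in> level 1" using bij_betw_lvl_up[OF x] by auto
  have "real A ^ H \<le> Atau X act par H z"
    using Atau_ge_power[OF A, of z] z H_pos by (cases H) auto
  also have "\<dots> \<le> (\<Sum>x\<in>level 1. Atau X act par H x)"
    using z Atau_pos by (intro member_le_sum) (auto simp: less_imp_le)
  finally show ?thesis by (simp only: sum_Atau_roots)
qed

text \<open>One factor \<open>A\<close> of the lower bound on \<open>Atau\<close> pays for the sum
  over the actions; the remaining \<open>A ^ (H - h)\<close> is the gain over the bound
  \<open>AX\<close>.\<close>

lemma sum_preach_pstar:
  assumes A: "\<forall>x\<in>X. card (act x) = A" and tr: "transition p0 P" and h: "h \<in> {1..H}"
  shows "(\<Sum>x\<in>level h. \<Sum>a\<in>act x. preach par H p0 P x / pstar X act par H x)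
    \<le> AX X act / real A ^ (H - h)"
proof -
  have Apos: "A > 0" using A card_act_pos X_nonempty by (metis ex_in_conv)
  have "(\<Sum>x\<in>level h. \<Sum>a\<in>act x. preach par H p0 P x / pstar X act par H x) * real A ^ (H - h)
     = (\<Sum>x\<in>level h. preach par H p0 P x / pstar X act par H x * real A ^ (Suc (H - lvl x)))"
    unfolding sum_distrib_right by (rule sum.cong) (use A in auto)
  also have "\<dots> \<le> (\<Sum>x\<in>level h. preach par H p0 P x / pstar X act par H x * Atau X act par H x)"
    using Atau_ge_power[OF A] preach_nonneg[OF tr] pstar_pos
    by (intro sum_mono mult_left_mono) (auto simp: less_imp_le simp del: power_Suc)
  also have "\<dots> \<le> AX X act" by (rule sum_preach_Atau_pstar[OF tr]) (use h in auto)
  finally show ?thesis using Apos by (simp add: pos_le_divide_eq)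
qed

end

section \<open>Entropy inequalities\<close>

text \<open>Multiply by \<open>exp y\<close>, which is at least \<open>1 + y + y^2 / 2\<close>: the
  two quadratics have product \<open>1 + y^4 / 4\<close>, which is at least 1.\<close>

lemma exp_minus_le_quadratic:
  fixes y :: real
  assumes "0 \<le> y"
  shows "exp (- y) \<le> 1 - y + y\<^sup>2 / 2"
proof -
  have "(1 - y + y\<^sup>2 / 2) * (1 + y + y\<^sup>2 / 2) = 1 + (y\<^sup>2)\<^sup>2 / 4"
    by (simp add: algebra_simps power2_eq_square)
  then have "1 \<le> (1 - y + y\<^sup>2 / 2) * (1 + y + y\<^sup>2 / 2)" by simp
  also have "\<dots> \<le> (1 - y + y\<^sup>2 / 2) * exp y"
  proof (rule mult_left_mono)
    show "1 + y + y\<^sup>2 / 2 \<le> exp y" using exp_lower_Taylor_quadratic[OF assms] .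
    have "0 \<le> (1 - y)\<^sup>2 + 1" by simp
    then show "0 \<le> 1 - y + y\<^sup>2 / 2" by (simp add: power2_eq_square algebra_simps)
  qed
  finally show ?thesis by (simp add: exp_minus field_simps)
qed

text \<open>Relative entropy of unnormalised masses, nonnegative by \<open>ln s \<le> s - 1\<close>
  at \<open>s = v / u\<close>. For \<open>u = 0\<close> the logarithmic term is zero and
  \<open>v\<close> remains.\<close>

lemma kl_nonneg:
  fixes u v :: real
  assumes "0 \<le> u" "0 \<le> v" "v = 0 \<Longrightarrow> u = 0"
  shows "0 \<le> u * ln (u / v) - u + v"
proof (cases "u = 0")
  case False
  then have pos: "u > 0" "v > 0" using assms by force+
  then have "u * ln (v / u) \<le> u * (v / u - 1)" by (intro mult_left_mono ln_le_minus_one) auto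
  then show ?thesis using pos by (simp add: ln_div algebra_simps)
qed (use assms in simp)

text \<open>The left side, as a function of \<open>u\<close>, is largest at
  \<open>v * exp (- \<eta> * l)\<close>. Nonnegativity of the divergence from \<open>u\<close> to
  that point states this, and the quadratic bound on the exponential evaluates the maximum.\<close>

lemma entropy_stability:
  fixes u v l \<eta> :: real
  assumes "0 \<le> u" "0 \<le> v" "v = 0 \<Longrightarrow> u = 0" "0 \<le> l" "0 < \<eta>"
  shows "(v - u) * l - 1 / \<eta> * (u * ln (u / v) - u + v) \<le> \<eta> / 2 * v * l\<^sup>2"
proof -
  let ?v = "v * exp (- \<eta> * l)"
  have "0 \<le> u * ln (u / ?v) - u + ?v" using assms by (intro kl_nonneg) auto
  also have "u * ln (u / ?v) = u * ln (u / v) + u * (\<eta> * l)"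
  proof (cases "u = 0")
    case False
    then have "u > 0" "v > 0" using assms by force+
    then show ?thesis by (simp add: ln_div ln_mult algebra_simps)
  qed simp
  also have "?v \<le> v * (1 - \<eta> * l + (\<eta> * l)\<^sup>2 / 2)"
    using exp_minus_le_quadratic[of "\<eta> * l"] assms by (intro mult_left_mono) auto
  finally have "\<eta> * ((v - u) * l) - (u * ln (u / v) - u + v) \<le> \<eta> * (\<eta> / 2 * v * l\<^sup>2)"
    by (simp add: algebra_simps power2_eq_square)
  then have "(\<eta> * ((v - u) * l) - (u * ln (u / v) - u + v)) / \<eta> \<le> \<eta> / 2 * v * l\<^sup>2"
    using assms(5) by (subst pos_divide_le_eq) (simp_all add: mult.commute)
  then show ?thesis using assms(5) by (simp add: diff_divide_distrib)
qed

text \<open>The convexity gap of \<open>w ln w\<close> at the mixture is exactly the mixture of the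
  divergences from \<open>w\<close> and from \<open>u\<close> to \<open>v\<close>. The first is
  dropped as nonnegative; the second is kept because it later pays for the stability term.\<close>

lemma entropy_mix_gap:
  fixes w u \<kappa> :: real
  assumes "0 \<le> w" "0 \<le> u" "0 < \<kappa>" "\<kappa> < 1"
  defines "v \<equiv> (1 - \<kappa>) * w + \<kappa> * u"
  shows "v * ln v \<le> (1 - \<kappa>) * (w * ln w) + \<kappa> * (u * ln u) - \<kappa> * (u * ln (u / v) - u + v)"
    and "v = 0 \<Longrightarrow> u = 0"
proof -
  have v0: "w = 0 \<and> u = 0" if "v = 0"
    using that assms by (simp add: v_def add_nonneg_eq_0_iff)
  then show "v = 0 \<Longrightarrow> u = 0" by blast
  have "0 \<le> v" using assms by (simp add: v_def)
  have ln_quot: "z * ln (z / v) = z * ln z - z * ln v" if "0 \<le> z" "v = 0 \<Longrightarrow> z = 0" for z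
  proof (cases "z = 0")
    case False
    then have "z > 0" "v > 0" using that \<open>0 \<le> v\<close> by force+
    then show ?thesis by (simp add: ln_div algebra_simps)
  qed simp
  have "0 \<le> (1 - \<kappa>) * (w * ln (w / v) - w + v)"
  proof (intro mult_nonneg_nonneg kl_nonneg)
    show "v = 0 \<Longrightarrow> w = 0" using v0 by blast
  qed (use \<open>0 \<le> w\<close> \<open>0 \<le> v\<close> \<open>\<kappa> < 1\<close> in simp_all)
  moreover have quot: "w * ln (w / v) = w * ln w - w * ln v" "u * ln (u / v) = u * ln u - u * ln v"
    using ln_quot v0 assms by blast+
  ultimately have "0 \<le> (1 - \<kappa>) * (w * ln w - w * ln v - w + v)" by simp
  moreover have "(1 - \<kappa>) * (v - w) + \<kappa> * (v - u) = 0" by (simp add: v_def algebra_simps)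
  moreover have "v * ln v = (1 - \<kappa>) * w * ln v + \<kappa> * u * ln v" by (simp add: v_def algebra_simps)
  ultimately show "v * ln v \<le> (1 - \<kappa>) * (w * ln w) + \<kappa> * (u * ln u) - \<kappa> * (u * ln (u / v) - u + v)"
    unfolding quot by (simp add: algebra_simps)
qed

text \<open>This is the limit of \<open>\<kappa>\<close> to 0. If \<open>a\<close> were positive,
  the chosen \<open>\<kappa>\<close> would make \<open>\<kappa> * c\<close> at most
  \<open>a / 2\<close>.\<close>

lemma nonpos_if_le_small_multiples:
  fixes a c :: real
  assumes "\<And>\<kappa>. 0 < \<kappa> \<Longrightarrow> \<kappa> < 1 \<Longrightarrow> a \<le> \<kappa> * c"
  shows "a \<le> 0"
proof (rule ccontr)
  assume "\<not> a \<le> 0"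
  then have a: "a > 0" by simp
  define \<kappa> where "\<kappa> = a / (2 * (a + \<bar>c\<bar>))"
  have k: "0 < \<kappa>" "\<kappa> < 1" using a by (auto simp: \<kappa>_def field_simps)
  have "\<kappa> * c \<le> \<kappa> * (a + \<bar>c\<bar>)" using k a by (intro mult_left_mono) auto
  also have "\<dots> = a / 2" using a by (simp add: \<kappa>_def field_simps)
  finally show False using assms[OF k] a by simp
qed

context info_tree
begin

section \<open>Follow the regularized leader\<close>

text \<open>Realization plans form a convex set. The policy realizing a mixture is the mixed plan of
  a pair divided by the mixed reach of its information set.\<close>

lemma policies_mix:
  assumes mu: "\<mu> \<in> policies X act" and mu': "\<mu>' \<in> policies X act" and k: "0 < \<kappa>" "\<kappa> < (1::real)"
  obtains \<nu> where "\<nu> \<in> policies X act"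
    "\<And>x a. x \<in> X \<Longrightarrow> a \<in> act x \<Longrightarrow>
       rplan par H \<nu> x a = (1 - \<kappa>) * rplan par H \<mu> x a + \<kappa> * rplan par H \<mu>' x a"
proof -
  define q where "q = (\<lambda>x. (1 - \<kappa>) * reach \<mu> x + \<kappa> * reach \<mu>' x)"
  \<comment> \<open>Where the mixed reach \<open>q x\<close> vanishes, any distribution will do,
    since both plans are zero there; that of \<open>\<mu>\<close> is taken.\<close>
  define \<nu> where "\<nu> = (\<lambda>x a. if q x = 0 then \<mu> x a
     else ((1 - \<kappa>) * rplan par H \<mu> x a + \<kappa> * rplan par H \<mu>' x a) / q x)"
  have q0: "0 \<le> q x" if "x \<in> X" for x
    using reach_nonneg[OF mu that] reach_nonneg[OF mu' that] k by (simp add: q_def)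
  have pol: "\<nu> \<in> policies X act"
    unfolding policies_def
  proof (intro CollectI ballI conjI)
    fix x a assume "x \<in> X" "a \<in> act x"
    then show "0 \<le> \<nu> x a"
      using k q0 rplan_nonneg[OF mu] rplan_nonneg[OF mu'] policiesD[OF mu] by (simp add: \<nu>_def)
  next
    fix x assume x: "x \<in> X"
    show "(\<Sum>a\<in>act x. \<nu> x a) = 1"
    proof (cases "q x = 0")
      case True
      then show ?thesis using policiesD[OF mu x] by (simp add: \<nu>_def)
    next
      case False
      have "(\<Sum>a\<in>act x. (1 - \<kappa>) * rplan par H \<mu> x a + \<kappa> * rplan par H \<mu>' x a) = q x"
        using policiesD[OF mu x] policiesD[OF mu' x]
        by (simp add: rplan_def q_def sum.distrib flip: sum_distrib_left)
      then show ?thesis using False by (simp add: \<nu>_def flip: sum_divide_distrib)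
    qed
  qed
  have mult: "q x * \<nu> x a = (1 - \<kappa>) * rplan par H \<mu> x a + \<kappa> * rplan par H \<mu>' x a" if x: "x \<in> X" for x a
  proof (cases "q x = 0")
    case True
    then have "reach \<mu> x = 0" "reach \<mu>' x = 0"
      using reach_nonneg[OF mu x] reach_nonneg[OF mu' x] k
      by (simp_all add: q_def add_nonneg_eq_0_iff)
    then show ?thesis using True by (simp add: rplan_def)
  qed (simp add: \<nu>_def)
  have "reach \<nu> x = q x" if "x \<in> X" for x
    using that
  proof (induction x rule: tree_induct)
    case (root x)
    then show ?case by (simp add: cprod_root q_def)
  next
    case (child x y b)
    then have "reach \<nu> x = q y * \<nu> y b" by (simp add: cprod_child)
    also have "\<dots> = (1 - \<kappa>) * rplan par H \<mu> y b + \<kappa> * rplan par H \<mu>' y b"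
      by (rule mult[OF child(3)])
    also have "\<dots> = q x"
      using child by (simp add: q_def cprod_child rplan_def mult.commute)
    finally show ?case .
  qed
  then have "rplan par H \<nu> x a = (1 - \<kappa>) * rplan par H \<mu> x a + \<kappa> * rplan par H \<mu>' x a"
    if "x \<in> X" for x a
    using mult[OF that] that by (simp add: rplan_def)
  then show ?thesis using that[OF pol] by blast
qed

abbreviation weight :: "('x \<Rightarrow> 'a \<Rightarrow> real) \<Rightarrow> 'x \<Rightarrow> 'a \<Rightarrow> real" where
  "weight \<mu> x a \<equiv> pstar X act par H x * rplan par H \<mu> x a"

lemma weight_nonneg: "\<mu> \<in> policies X act \<Longrightarrow> x \<in> X \<Longrightarrow> a \<in> act x \<Longrightarrow> 0 \<le> weight \<mu> x a"
  using rplan_nonneg pstar_pos by (simp add: less_imp_le)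

lemma ftrl_obj_alt:
  "ftrl_obj X lvl act par H eta L \<mu> =
    (\<Sum>x\<in>X. \<Sum>a\<in>act x. rplan par H \<mu> x a * L x a
       + 1 / eta (lvl x) * (weight \<mu> x a * ln (weight \<mu> x a)))"
proof -
  have "(\<Sum>h\<in>{1..H}. 1 / eta h * (\<Sum>x\<in>level h. \<Sum>a\<in>act x. weight \<mu> x a * ln (weight \<mu> x a)))
    = (\<Sum>h\<in>{1..H}. \<Sum>x\<in>level h. \<Sum>a\<in>act x. 1 / eta (lvl x) * (weight \<mu> x a * ln (weight \<mu> x a)))"
    unfolding sum_distrib_left by (intro sum.cong refl) auto
  also have "\<dots> = (\<Sum>x\<in>X. \<Sum>a\<in>act x. 1 / eta (lvl x) * (weight \<mu> x a * ln (weight \<mu> x a)))"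
    by (rule sum_levels[symmetric])
  finally show ?thesis
    unfolding ftrl_obj_def ip_def Let_def sum.distrib by (rule arg_cong)
qed

lemma ftrl_obj_add:
  "ftrl_obj X lvl act par H eta (\<lambda>x a. L x a + l x a) \<mu>
    = ftrl_obj X lvl act par H eta L \<mu> + ip X act par H \<mu> l"
  by (simp add: ftrl_obj_def ip_def algebra_simps sum.distrib)

text \<open>Pairing \<open>rplan\<close> with \<open>l\<close> is the same as pairing
  \<open>weight\<close> with \<open>l / pstar\<close>. In these coordinates the sum is the usual
  second-order term of entropic regularization, with one rate per level.\<close>

definition stability :: "(nat \<Rightarrow> real) \<Rightarrow> ('x \<Rightarrow> 'a \<Rightarrow> real) \<Rightarrow> ('x \<Rightarrow> 'a \<Rightarrow> real) \<Rightarrow> real" where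
  "stability eta \<mu> l =
    (\<Sum>x\<in>X. \<Sum>a\<in>act x. eta (lvl x) / 2 * weight \<mu> x a * (l x a / pstar X act par H x)\<^sup>2)"

text \<open>Comparing the minimiser with a small step towards \<open>\<mu>'\<close>, rather than differentiating at the
  minimiser, avoids having to know that the minimiser lies in the interior.\<close>

lemma ftrl_step:
  assumes eta: "\<And>h. h \<in> {1..H} \<Longrightarrow> 0 < eta h"
    and l: "\<And>x a. x \<in> X \<Longrightarrow> a \<in> act x \<Longrightarrow> 0 \<le> l x a"
    and mu: "\<mu> \<in> policies X act" and mu': "\<mu>' \<in> policies X act"
    and min: "\<forall>\<nu>\<in>policies X act.
      ftrl_obj X lvl act par H eta L \<mu> \<le> ftrl_obj X lvl act par H eta L \<nu>"
  shows "ip X act par H \<mu> l + ftrl_obj X lvl act par H eta L \<mu>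
    \<le> ip X act par H \<mu>' l + ftrl_obj X lvl act par H eta L \<mu>' + stability eta \<mu> l"
proof -
  let ?\<Phi> = "ftrl_obj X lvl act par H eta L"
  let ?G = "ip X act par H \<mu> l - ip X act par H \<mu>' l"
  let ?k = "\<lambda>x a. l x a / pstar X act par H x"
  \<comment> \<open>The claim holds up to an error linear in the length \<open>\<kappa>\<close> of
    the step towards \<open>\<mu>'\<close>; letting \<open>\<kappa>\<close> shrink removes
    it.\<close>
  have bound: "?G - (?\<Phi> \<mu>' - ?\<Phi> \<mu>) - stability eta \<mu> l
      \<le> \<kappa> * (?G + stability eta \<mu>' l - stability eta \<mu> l)"
    if k: "0 < \<kappa>" "\<kappa> < 1" for \<kappa> :: real
  proof -
    obtain \<nu> where nu: "\<nu> \<in> policies X act" and r: "\<And>x a. x \<in> X \<Longrightarrow> a \<in> act x \<Longrightarrow>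
       rplan par H \<nu> x a = (1 - \<kappa>) * rplan par H \<mu> x a + \<kappa> * rplan par H \<mu>' x a"
      using policies_mix[OF mu mu' k] by blast
    have w: "weight \<nu> x a = (1 - \<kappa>) * weight \<mu> x a + \<kappa> * weight \<mu>' x a"
      if "x \<in> X" "a \<in> act x" for x a
      unfolding r[OF that] by (simp add: algebra_simps)
    define D where "D = (\<lambda>x a. weight \<mu>' x a * ln (weight \<mu>' x a / weight \<nu> x a)
       - weight \<mu>' x a + weight \<nu> x a)"
    have etax: "0 < eta (lvl x)" if "x \<in> X" for x using eta lvl_range[OF that] by blast
    have "?\<Phi> \<nu> \<le> (\<Sum>x\<in>X. \<Sum>a\<in>act x.
        (1 - \<kappa>) * (rplan par H \<mu> x a * L x a + 1 / eta (lvl x) * (weight \<mu> x a * ln (weight \<mu> x a)))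
        + \<kappa> * (rplan par H \<mu>' x a * L x a + 1 / eta (lvl x) * (weight \<mu>' x a * ln (weight \<mu>' x a)))
        - \<kappa> * (1 / eta (lvl x) * D x a))"
      unfolding ftrl_obj_alt
    proof (intro sum_mono)
      fix x a assume xa: "x \<in> X" "a \<in> act x"
      have "weight \<nu> x a * ln (weight \<nu> x a)
        \<le> (1 - \<kappa>) * (weight \<mu> x a * ln (weight \<mu> x a)) + \<kappa> * (weight \<mu>' x a * ln (weight \<mu>' x a))
          - \<kappa> * D x a"
        using entropy_mix_gap(1)[OF weight_nonneg[OF mu xa] weight_nonneg[OF mu' xa] k]
        unfolding D_def w[OF xa] .
      then have "1 / eta (lvl x) * (weight \<nu> x a * ln (weight \<nu> x a))
        \<le> 1 / eta (lvl x) * ((1 - \<kappa>) * (weight \<mu> x a * ln (weight \<mu> x a))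
          + \<kappa> * (weight \<mu>' x a * ln (weight \<mu>' x a)) - \<kappa> * D x a)"
        using etax[OF xa(1)] by (intro mult_left_mono) auto
      then show "rplan par H \<nu> x a * L x a + 1 / eta (lvl x) * (weight \<nu> x a * ln (weight \<nu> x a))
        \<le> (1 - \<kappa>) * (rplan par H \<mu> x a * L x a + 1 / eta (lvl x) * (weight \<mu> x a * ln (weight \<mu> x a)))
        + \<kappa> * (rplan par H \<mu>' x a * L x a + 1 / eta (lvl x) * (weight \<mu>' x a * ln (weight \<mu>' x a)))
        - \<kappa> * (1 / eta (lvl x) * D x a)"
        unfolding r[OF xa] by (simp only: distrib_left right_diff_distrib distrib_right mult_ac)
    qed
    also have "\<dots> = (1 - \<kappa>) * ?\<Phi> \<mu> + \<kappa> * ?\<Phi> \<mu>' - \<kappa> * (\<Sum>x\<in>X. \<Sum>a\<in>act x. 1 / eta (lvl x) * D x a)"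
      unfolding ftrl_obj_alt sum.distrib sum_subtractf sum_distrib_left distrib_left ..
    \<comment> \<open>Minimality of \<open>\<mu>\<close> gives
      \<open>?\<Phi> \<mu> \<le> ?\<Phi> \<nu>\<close>. After cancellation everything carries a
      factor \<open>\<kappa>\<close>, so the divergence from \<open>\<mu>'\<close> to
      \<open>\<nu>\<close> is bounded by the objective gap.\<close>
    finally have "\<kappa> * (\<Sum>x\<in>X. \<Sum>a\<in>act x. 1 / eta (lvl x) * D x a) \<le> \<kappa> * (?\<Phi> \<mu>' - ?\<Phi> \<mu>)"
      using min nu by (force simp: algebra_simps)
    then have D: "(\<Sum>x\<in>X. \<Sum>a\<in>act x. 1 / eta (lvl x) * D x a) \<le> ?\<Phi> \<mu>' - ?\<Phi> \<mu>"
      using k by simp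
    \<comment> \<open>Stability is applied at the mixture \<open>\<nu>\<close> because its weight
      can vanish only where that of \<open>\<mu>'\<close> does, which need not hold for
      \<open>\<mu>\<close>.\<close>
    have "(\<Sum>x\<in>X. \<Sum>a\<in>act x. (weight \<nu> x a - weight \<mu>' x a) * ?k x a - 1 / eta (lvl x) * D x a)
      \<le> (\<Sum>x\<in>X. \<Sum>a\<in>act x. eta (lvl x) / 2 * weight \<nu> x a * (?k x a)\<^sup>2)"
    proof (intro sum_mono)
      fix x a assume xa: "x \<in> X" "a \<in> act x"
      show "(weight \<nu> x a - weight \<mu>' x a) * ?k x a - 1 / eta (lvl x) * D x a
        \<le> eta (lvl x) / 2 * weight \<nu> x a * (?k x a)\<^sup>2"
        unfolding D_def
      proof (rule entropy_stability)
        show "weight \<nu> x a = 0 \<Longrightarrow> weight \<mu>' x a = 0"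
          using entropy_mix_gap(2)[OF weight_nonneg[OF mu xa] weight_nonneg[OF mu' xa] k]
          unfolding w[OF xa] .
      qed (use weight_nonneg[OF mu' xa] weight_nonneg[OF nu xa] l[OF xa] pstar_pos[OF xa(1)]
            etax[OF xa(1)] in auto)
    qed
    also have "\<dots> = (1 - \<kappa>) * stability eta \<mu> l + \<kappa> * stability eta \<mu>' l"
      unfolding stability_def sum_distrib_left sum.distrib[symmetric]
    proof (intro sum.cong refl)
      fix x a assume "x \<in> X" "a \<in> act x"
      then show "eta (lvl x) / 2 * weight \<nu> x a * (?k x a)\<^sup>2 =
        (1 - \<kappa>) * (eta (lvl x) / 2 * weight \<mu> x a * (?k x a)\<^sup>2)
        + \<kappa> * (eta (lvl x) / 2 * weight \<mu>' x a * (?k x a)\<^sup>2)"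
        by (simp only: w distrib_left distrib_right mult_ac)
    qed
    also have "(\<Sum>x\<in>X. \<Sum>a\<in>act x. (weight \<nu> x a - weight \<mu>' x a) * ?k x a - 1 / eta (lvl x) * D x a)
      = (1 - \<kappa>) * ?G - (\<Sum>x\<in>X. \<Sum>a\<in>act x. 1 / eta (lvl x) * D x a)"
    proof -
      have "(\<Sum>x\<in>X. \<Sum>a\<in>act x. (weight \<nu> x a - weight \<mu>' x a) * ?k x a) = (1 - \<kappa>) * ?G"
        unfolding ip_def sum_subtractf[symmetric] sum_distrib_left
      proof (intro sum.cong refl)
        fix x a assume xa: "x \<in> X" "a \<in> act x"
        then show "(weight \<nu> x a - weight \<mu>' x a) * ?k x a
          = (1 - \<kappa>) * (rplan par H \<mu> x a * l x a - rplan par H \<mu>' x a * l x a)"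
          using pstar_pos[OF xa(1)] by (simp add: r field_simps)
      qed
      then show ?thesis by (simp only: sum_subtractf)
    qed
    finally show ?thesis using D by (simp add: algebra_simps)
  qed
  then show ?thesis using nonpos_if_le_small_multiples[OF bound] by linarith
qed

text \<open>Adding \<open>ftrl_step\<close> over the episodes telescopes the objectives. The
  induction hypothesis is for all comparators \<open>\<nu>\<close>, since the step from
  \<open>n\<close> needs it at the next iterate \<open>\<mu> (Suc n)\<close>.\<close>

lemma ftrl_regret:
  fixes T :: nat
  assumes eta: "\<And>h. h \<in> {1..H} \<Longrightarrow> 0 < eta h"
    and l: "\<And>t x a. t \<in> {1..T} \<Longrightarrow> x \<in> X \<Longrightarrow> a \<in> act x \<Longrightarrow> 0 \<le> l t x a"
    and ftrl: "\<And>t. t \<in> {1..T} \<Longrightarrow> \<mu> t \<in> policies X act \<and> (\<forall>\<nu>\<in>policies X act.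
        ftrl_obj X lvl act par H eta (\<lambda>x a. \<Sum>k\<in>{1..<t}. l k x a) (\<mu> t)
        \<le> ftrl_obj X lvl act par H eta (\<lambda>x a. \<Sum>k\<in>{1..<t}. l k x a) \<nu>)"
    and T: "1 \<le> T" and mu': "\<mu>' \<in> policies X act"
  shows "(\<Sum>t\<in>{1..T}. ip X act par H (\<mu> t) (l t) - ip X act par H \<mu>' (l t))
    \<le> ftrl_obj X lvl act par H eta (\<lambda>x a. 0) \<mu>' - ftrl_obj X lvl act par H eta (\<lambda>x a. 0) (\<mu> 1)
      + (\<Sum>t\<in>{1..T}. stability eta (\<mu> t) (l t))"
proof -
  let ?\<Phi> = "\<lambda>n. ftrl_obj X lvl act par H eta (\<lambda>x a. \<Sum>k\<in>{1..<Suc n}. l k x a)"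
  have "(\<Sum>t\<in>{1..n}. ip X act par H (\<mu> t) (l t)) + ?\<Phi> 0 (\<mu> 1)
    \<le> ?\<Phi> n \<nu> + (\<Sum>t\<in>{1..n}. stability eta (\<mu> t) (l t))"
    if "n \<le> T" "\<nu> \<in> policies X act" for n \<nu>
    using that
  proof (induction n arbitrary: \<nu>)
    case 0
    then show ?case using ftrl[of 1] T by simp
  next
    case (Suc n)
    have n: "Suc n \<in> {1..T}" using Suc.prems by simp
    have "ip X act par H (\<mu> (Suc n)) (l (Suc n)) + ?\<Phi> n (\<mu> (Suc n))
      \<le> ip X act par H \<nu> (l (Suc n)) + ?\<Phi> n \<nu> + stability eta (\<mu> (Suc n)) (l (Suc n))"
      using ftrl[OF n] by (intro ftrl_step eta l[OF n] Suc.prems) auto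
    moreover have "?\<Phi> (Suc n) \<nu> = ?\<Phi> n \<nu> + ip X act par H \<nu> (l (Suc n))"
      by (subst ftrl_obj_add[symmetric]) simp
    ultimately show ?case using Suc.IH[of "\<mu> (Suc n)"] ftrl[OF n] n by simp
  qed
  from this[of T \<mu>'] mu' have "(\<Sum>t\<in>{1..T}. ip X act par H (\<mu> t) (l t)) + ?\<Phi> 0 (\<mu> 1)
    \<le> ?\<Phi> T \<mu>' + (\<Sum>t\<in>{1..T}. stability eta (\<mu> t) (l t))" by simp
  moreover have "?\<Phi> T \<mu>' = ftrl_obj X lvl act par H eta (\<lambda>x a. 0) \<mu>'
      + (\<Sum>t\<in>{1..T}. ip X act par H \<mu>' (l t))"
  proof -
    have "ip X act par H \<mu>' (\<lambda>x a. \<Sum>k\<in>{1..T}. l k x a) = (\<Sum>t\<in>{1..T}. ip X act par H \<mu>' (l t))"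
      unfolding ip_def sum_distrib_left
      by (subst sum.swap[of _ "{1..T}"], subst sum.swap[of _ "{1..T}"]) simp
    then show ?thesis
      using ftrl_obj_add[of eta "\<lambda>x a. 0" "\<lambda>x a. \<Sum>k\<in>{1..T}. l k x a" \<mu>']
      by (simp add: atLeastLessThanSuc_atLeastAtMost)
  qed
  ultimately show ?thesis by (simp add: sum_subtractf)
qed

text \<open>The weights of a level are nonnegative and sum to one, so each lies in [0, 1], where
  \<open>w ln w\<close> is nonpositive.\<close>

lemma regularizer_nonpos:
  assumes eta: "\<And>h. h \<in> {1..H} \<Longrightarrow> 0 < eta h" and mu: "\<mu> \<in> policies X act"
  shows "ftrl_obj X lvl act par H eta (\<lambda>x a. 0) \<mu> \<le> 0"
proof -
  have w1: "weight \<mu> x a \<le> 1" if xa: "x \<in> X" "a \<in> act x" for x a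
  proof -
    have "weight \<mu> x a \<le> (\<Sum>a\<in>act x. weight \<mu> x a)"
      using xa weight_nonneg[OF mu] finite_act by (intro member_le_sum) auto
    also have "\<dots> \<le> (\<Sum>x'\<in>level (lvl x). \<Sum>a\<in>act x'. weight \<mu> x' a)"
      using xa weight_nonneg[OF mu] by (intro member_le_sum sum_nonneg) auto
    also have "\<dots> = 1" using sum_pstar_rplan[OF mu lvl_range[OF xa(1)]] .
    finally show ?thesis .
  qed
  have "weight \<mu> x a * ln (weight \<mu> x a) \<le> 0" if xa: "x \<in> X" "a \<in> act x" for x a
    using weight_nonneg[OF mu xa] w1[OF xa]
    by (intro mult_nonneg_nonpos) (metis ln_le_zero_iff ln_0 order.order_iff_strict order_refl)+
  then have "0 \<le> 1 / eta (lvl x) * - (weight \<mu> x a * ln (weight \<mu> x a))" if "x \<in> X" "a \<in> act x" for x a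
    using eta[OF lvl_range[OF that(1)]] that by (intro mult_nonneg_nonneg) auto
  then show ?thesis unfolding ftrl_obj_alt by (intro sum_nonpos) auto
qed

text \<open>Compare the weights of a level with the constant mass \<open>1 / AX\<close> per pair by
  \<open>kl_nonneg\<close>. A level has at most \<open>AX\<close> pairs, so the reference has total
  mass at most one.\<close>

lemma regularizer_ge:
  assumes eta: "\<And>h. h \<in> {1..H} \<Longrightarrow> 0 < eta h" and mu: "\<mu> \<in> policies X act"
  shows "- (\<Sum>h\<in>{1..H}. ln (AX X act) / eta h) \<le> ftrl_obj X lvl act par H eta (\<lambda>x a. 0) \<mu>"
proof -
  let ?N = "AX X act"
  have "- (ln ?N / eta h) \<le> 1 / eta h * (\<Sum>x\<in>level h. \<Sum>a\<in>act x. weight \<mu> x a * ln (weight \<mu> x a))"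
    if h: "h \<in> {1..H}" for h
  proof -
    have "0 \<le> (\<Sum>x\<in>level h. \<Sum>a\<in>act x. weight \<mu> x a * ln (weight \<mu> x a)
        + weight \<mu> x a * ln ?N - weight \<mu> x a + 1 / ?N)"
    proof (intro sum_nonneg)
      fix x a assume "x \<in> level h" "a \<in> act x"
      then have w: "0 \<le> weight \<mu> x a" using weight_nonneg[OF mu] by simp
      have "0 \<le> weight \<mu> x a * ln (weight \<mu> x a / (1 / ?N)) - weight \<mu> x a + 1 / ?N"
        using w AX_pos by (intro kl_nonneg) auto
      also have "weight \<mu> x a * ln (weight \<mu> x a / (1 / ?N))
          = weight \<mu> x a * ln (weight \<mu> x a) + weight \<mu> x a * ln ?N"
      proof (cases "weight \<mu> x a = 0")
        case False
        then have "ln (weight \<mu> x a / (1 / ?N)) = ln (weight \<mu> x a) + ln ?N"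
          using w AX_pos unfolding divide_divide_eq_right div_by_1
          by (intro ln_mult_pos) linarith+
        then show ?thesis by (simp only: distrib_left)
      qed (simp only: mult_zero_left add_0)
      finally show "0 \<le> weight \<mu> x a * ln (weight \<mu> x a) + weight \<mu> x a * ln ?N - weight \<mu> x a + 1 / ?N" .
    qed
    also have "\<dots> = (\<Sum>x\<in>level h. \<Sum>a\<in>act x. weight \<mu> x a * ln (weight \<mu> x a))
      + (\<Sum>x\<in>level h. \<Sum>a\<in>act x. weight \<mu> x a) * ln ?N
      - (\<Sum>x\<in>level h. \<Sum>a\<in>act x. weight \<mu> x a) + (\<Sum>x\<in>level h. \<Sum>a\<in>act x. 1 / ?N)"
      unfolding sum.distrib sum_subtractf sum_distrib_right ..
    also have "(\<Sum>x\<in>level h. \<Sum>a\<in>act x. weight \<mu> x a) = 1" by (rule sum_pstar_rplan[OF mu h])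
    also have "(\<Sum>x\<in>level h. \<Sum>a\<in>act x. 1 / ?N) \<le> 1"
    proof -
      have "(\<Sum>x\<in>level h. \<Sum>a\<in>act x. 1 / ?N) = (\<Sum>x\<in>level h. real (card (act x))) / ?N"
        by (simp add: sum_divide_distrib)
      also have "\<dots> \<le> ?N / ?N"
        unfolding AX_def by (intro divide_right_mono sum_mono2 sum_nonneg) auto
      finally show ?thesis using AX_pos by simp
    qed
    finally have "- ln ?N \<le> (\<Sum>x\<in>level h. \<Sum>a\<in>act x. weight \<mu> x a * ln (weight \<mu> x a))" by simp
    from mult_left_mono[OF this, of "1 / eta h"] eta[OF h] show ?thesis by simp
  qed
  then have "(\<Sum>h\<in>{1..H}. - (ln ?N / eta h)) \<le> (\<Sum>h\<in>{1..H}.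
      1 / eta h * (\<Sum>x\<in>level h. \<Sum>a\<in>act x. weight \<mu> x a * ln (weight \<mu> x a)))"
    by (rule sum_mono)
  then show ?thesis unfolding ftrl_obj_def by (simp add: ip_def Let_def sum_negf)
qed

end

context info_tree
begin

section \<open>Regret decomposition\<close>

lemma sum_level_preach_pstar:
  assumes A: "\<forall>x\<in>X. card (act x) = A" and tr: "transition p0 P"
    and c: "\<And>h. h \<in> {1..H} \<Longrightarrow> 0 \<le> c h"
  shows "(\<Sum>x\<in>X. \<Sum>a\<in>act x. c (lvl x) * (preach par H p0 P x / pstar X act par H x))
    \<le> (\<Sum>h\<in>{1..H}. c h * (AX X act / real A ^ (H - h)))"
proof -
  have "(\<Sum>x\<in>X. \<Sum>a\<in>act x. c (lvl x) * (preach par H p0 P x / pstar X act par H x))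
    = (\<Sum>h\<in>{1..H}. c h * (\<Sum>x\<in>level h. \<Sum>a\<in>act x. preach par H p0 P x / pstar X act par H x))"
    unfolding sum_distrib_left by (subst sum_levels) (intro sum.cong refl, auto)
  also have "\<dots> \<le> (\<Sum>h\<in>{1..H}. c h * (AX X act / real A ^ (H - h)))"
    using c by (intro sum_mono mult_left_mono sum_preach_pstar[OF A tr])
  finally show ?thesis .
qed

lemma lossf_bounds:
  assumes "transition p0 P" "x \<in> X" "0 \<le> r x a" "r x a \<le> 1"
  shows "0 \<le> lossf par H p0 P r x a" "lossf par H p0 P r x a \<le> preach par H p0 P x"
proof -
  show "0 \<le> lossf par H p0 P r x a"
    using assms preach_nonneg[OF assms(1,2)] by (simp add: lossf_def)
  have "preach par H p0 P x * (1 - r x a) \<le> preach par H p0 P x * 1"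
    using assms preach_nonneg[OF assms(1,2)] by (intro mult_left_mono) auto
  then show "lossf par H p0 P r x a \<le> preach par H p0 P x" by (simp add: lossf_def)
qed

text \<open>The loss of a pair is at most its reach probability, and every level carries visiting
  mass one.\<close>

lemma ip_lossf_bounds:
  assumes tr: "transition p0 P" and mu: "\<mu> \<in> policies X act"
    and r: "\<And>x a. x \<in> X \<Longrightarrow> a \<in> act x \<Longrightarrow> 0 \<le> r x a \<and> r x a \<le> 1"
  shows "0 \<le> ip X act par H \<mu> (lossf par H p0 P r)" "ip X act par H \<mu> (lossf par H p0 P r) \<le> real H"
proof -
  show "0 \<le> ip X act par H \<mu> (lossf par H p0 P r)"
    unfolding ip_def using rplan_nonneg[OF mu] lossf_bounds[OF tr] r
    by (intro sum_nonneg mult_nonneg_nonneg) auto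
  have "ip X act par H \<mu> (lossf par H p0 P r)
    \<le> (\<Sum>x\<in>X. \<Sum>a\<in>act x. preach par H p0 P x * rplan par H \<mu> x a)"
    unfolding ip_def
  proof (intro sum_mono)
    fix x a assume xa: "x \<in> X" "a \<in> act x"
    have "rplan par H \<mu> x a * lossf par H p0 P r x a \<le> rplan par H \<mu> x a * preach par H p0 P x"
      using rplan_nonneg[OF mu] lossf_bounds[OF tr] r xa by (intro mult_left_mono) auto
    then show "rplan par H \<mu> x a * lossf par H p0 P r x a \<le> preach par H p0 P x * rplan par H \<mu> x a"
      by (simp add: mult.commute)
  qed
  also have "\<dots> = (\<Sum>h\<in>{1..H}. \<Sum>x\<in>level h. \<Sum>a\<in>act x. preach par H p0 P x * rplan par H \<mu> x a)"
    by (rule sum_levels)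
  also have "\<dots> = (\<Sum>h\<in>{1..H}. 1)"
    by (intro sum.cong refl sum_preach_rplan[OF tr mu])
  finally show "ip X act par H \<mu> (lossf par H p0 P r) \<le> real H" by simp
qed

text \<open>The conditional mean of \<open>ip \<mu> est\<close> when \<open>est\<close> is the implicit-exploration estimate of the loss \<open>l\<close>.\<close>

definition ix_mean :: "(nat \<Rightarrow> real) \<Rightarrow> ('x \<Rightarrow> 'a \<Rightarrow> real) \<Rightarrow> ('x \<Rightarrow> 'a \<Rightarrow> real) \<Rightarrow> real" where
  "ix_mean gam \<mu> l = (\<Sum>x\<in>X. \<Sum>a\<in>act x.
     rplan par H \<mu> x a / (rplan par H \<mu> x a + gam (lvl x) / pstar X act par H x)
       * (rplan par H \<mu> x a * l x a))"

text \<open>With \<open>g = gam / pstar\<close>, the bias of a pair is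
  \<open>m / (m + g) * g * l\<close>, hence at most \<open>g\<close> times the reach probability.
  The balanced level sums then apply.\<close>

lemma ip_minus_ix_mean:
  assumes A: "\<forall>x\<in>X. card (act x) = A" and tr: "transition p0 P" and mu: "\<mu> \<in> policies X act"
    and r: "\<And>x a. x \<in> X \<Longrightarrow> a \<in> act x \<Longrightarrow> 0 \<le> r x a \<and> r x a \<le> 1"
    and gam: "\<And>h. h \<in> {1..H} \<Longrightarrow> 0 < gam h"
  shows "ip X act par H \<mu> (lossf par H p0 P r) - ix_mean gam \<mu> (lossf par H p0 P r)
    \<le> (\<Sum>h\<in>{1..H}. gam h * (AX X act / real A ^ (H - h)))"
proof -
  have "ip X act par H \<mu> (lossf par H p0 P r) - ix_mean gam \<mu> (lossf par H p0 P r)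
    \<le> (\<Sum>x\<in>X. \<Sum>a\<in>act x. gam (lvl x) * (preach par H p0 P x / pstar X act par H x))"
    unfolding ip_def ix_mean_def sum_subtractf[symmetric]
  proof (intro sum_mono)
    fix x a assume xa: "x \<in> X" "a \<in> act x"
    define m where "m = rplan par H \<mu> x a"
    define g where "g = gam (lvl x) / pstar X act par H x"
    define l where "l = lossf par H p0 P r x a"
    have m: "0 \<le> m" using rplan_nonneg[OF mu xa] by (simp add: m_def)
    have g: "0 < g" using gam[OF lvl_range[OF xa(1)]] pstar_pos[OF xa(1)] by (simp add: g_def)
    have l: "0 \<le> l" "l \<le> preach par H p0 P x" using lossf_bounds[OF tr xa(1)] r[OF xa] by (auto simp: l_def)
    have "m * l - m / (m + g) * (m * l) = m / (m + g) * (g * l)"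
      using m g by (simp add: field_simps)
    also have "\<dots> \<le> 1 * (g * l)" using m g l by (intro mult_right_mono) auto
    also have "\<dots> \<le> g * preach par H p0 P x" using g l by (simp add: mult_left_mono)
    finally show "rplan par H \<mu> x a * lossf par H p0 P r x a -
        rplan par H \<mu> x a / (rplan par H \<mu> x a + gam (lvl x) / pstar X act par H x)
          * (rplan par H \<mu> x a * lossf par H p0 P r x a)
      \<le> gam (lvl x) * (preach par H p0 P x / pstar X act par H x)"
      by (simp add: m_def g_def l_def)
  qed
  also have "\<dots> \<le> (\<Sum>h\<in>{1..H}. gam h * (AX X act / real A ^ (H - h)))"
    using gam by (intro sum_level_preach_pstar[OF A tr] less_imp_le)
  finally show ?thesis .
qed

text \<open>This is a statement about one sample path: all randomness is confined to
  \<open>over\<close> and \<open>under\<close>. The hypothesis \<open>over\<close> is used twice,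
  for the comparator and for the stability term.\<close>

lemma regret_decomposition:
  fixes T :: nat
  assumes A: "\<forall>x\<in>X. card (act x) = A"
    and eta: "\<And>h. h \<in> {1..H} \<Longrightarrow> 0 < eta h" and gam: "\<And>h. h \<in> {1..H} \<Longrightarrow> 0 < gam h"
    and T: "1 \<le> T"
    and tr: "\<And>t. t \<in> {1..T} \<Longrightarrow> transition (p0 t) (P t)"
    and r: "\<And>t x a. t \<in> {1..T} \<Longrightarrow> x \<in> X \<Longrightarrow> a \<in> act x \<Longrightarrow> 0 \<le> r t x a \<and> r t x a \<le> 1"
    and est: "\<And>t x a. t \<in> {1..T} \<Longrightarrow> x \<in> X \<Longrightarrow> a \<in> act x \<Longrightarrow> 0 \<le> est t x a"
    and est1: "\<And>t x a. t \<in> {1..T} \<Longrightarrow> x \<in> X \<Longrightarrow> a \<in> act x \<Longrightarrow> rplan par H (\<mu> t) x a * est t x a \<le> 1"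
    and ftrl: "\<And>t. t \<in> {1..T} \<Longrightarrow> \<mu> t \<in> policies X act \<and> (\<forall>\<nu>\<in>policies X act.
        ftrl_obj X lvl act par H eta (\<lambda>x a. \<Sum>k\<in>{1..<t}. est k x a) (\<mu> t)
        \<le> ftrl_obj X lvl act par H eta (\<lambda>x a. \<Sum>k\<in>{1..<t}. est k x a) \<nu>)"
    and over: "\<And>x a. x \<in> X \<Longrightarrow> a \<in> act x \<Longrightarrow>
        (\<Sum>t\<in>{1..T}. est t x a - lossf par H (p0 t) (P t) (r t) x a)
        \<le> \<iota> / (2 * gam (lvl x)) * pstar X act par H x"
    and under: "(\<Sum>t\<in>{1..T}. ix_mean gam (\<mu> t) (lossf par H (p0 t) (P t) (r t))
        - ip X act par H (\<mu> t) (est t)) \<le> D"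
    and mu': "\<mu>' \<in> policies X act"
  shows "(\<Sum>t\<in>{1..T}. ip X act par H (\<mu> t) (lossf par H (p0 t) (P t) (r t))
        - ip X act par H \<mu>' (lossf par H (p0 t) (P t) (r t)))
    \<le> (\<Sum>h\<in>{1..H}. ln (AX X act) / eta h)
      + real T * (\<Sum>h\<in>{1..H}. eta h / 2 * (AX X act / real A ^ (H - h)))
      + (\<Sum>x\<in>X. \<Sum>a\<in>act x. eta (lvl x) / 2 * (\<iota> / (2 * gam (lvl x))))
      + (\<Sum>h\<in>{1..H}. \<iota> / (2 * gam h))
      + real T * (\<Sum>h\<in>{1..H}. gam h * (AX X act / real A ^ (H - h))) + D"
proof -
  let ?l = "\<lambda>t. lossf par H (p0 t) (P t) (r t)"
  let ?p = "pstar X act par H"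
  have mu: "\<mu> t \<in> policies X act" if "t \<in> {1..T}" for t using ftrl[OF that] by blast
  have "(\<Sum>t\<in>{1..T}. ip X act par H (\<mu> t) (?l t) - ix_mean gam (\<mu> t) (?l t))
    \<le> (\<Sum>t\<in>{1..T}. \<Sum>h\<in>{1..H}. gam h * (AX X act / real A ^ (H - h)))"
    by (intro sum_mono ip_minus_ix_mean[OF A]) (use tr mu r gam in blast)+
  then have bias1: "(\<Sum>t\<in>{1..T}. ip X act par H (\<mu> t) (?l t) - ix_mean gam (\<mu> t) (?l t))
    \<le> real T * (\<Sum>h\<in>{1..H}. gam h * (AX X act / real A ^ (H - h)))" by simp
  have "(\<Sum>t\<in>{1..T}. ip X act par H \<mu>' (est t) - ip X act par H \<mu>' (?l t))
    = (\<Sum>t\<in>{1..T}. \<Sum>x\<in>X. \<Sum>a\<in>act x. rplan par H \<mu>' x a * (est t x a - ?l t x a))"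
    by (simp add: ip_def right_diff_distrib sum_subtractf)
  also have "\<dots> = (\<Sum>x\<in>X. \<Sum>a\<in>act x. rplan par H \<mu>' x a * (\<Sum>t\<in>{1..T}. est t x a - ?l t x a))"
    unfolding sum_distrib_left
    by (subst sum.swap, intro sum.cong refl, subst sum.swap) simp
  \<comment> \<open>The excess allowed for a pair is proportional to \<open>pstar\<close>, and
    \<open>pstar\<close> times the comparator's plan has mass one per level. The bound therefore
    holds for all comparators at once, without a union over policies.\<close>
  also have "\<dots> \<le> (\<Sum>x\<in>X. \<Sum>a\<in>act x. rplan par H \<mu>' x a * (\<iota> / (2 * gam (lvl x)) * ?p x))"
    using rplan_nonneg[OF mu'] over by (intro sum_mono mult_left_mono)
  also have "\<dots> = (\<Sum>h\<in>{1..H}. \<iota> / (2 * gam h) * (\<Sum>x\<in>level h. \<Sum>a\<in>act x. ?p x * rplan par H \<mu>' x a))"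
    unfolding sum_distrib_left by (subst sum_levels) (intro sum.cong refl, auto)
  also have "\<dots> = (\<Sum>h\<in>{1..H}. \<iota> / (2 * gam h) * 1)"
    using sum_pstar_rplan[OF mu'] by (intro sum.cong refl) simp
  finally have bias2: "(\<Sum>t\<in>{1..T}. ip X act par H \<mu>' (est t) - ip X act par H \<mu>' (?l t))
    \<le> (\<Sum>h\<in>{1..H}. \<iota> / (2 * gam h))" by simp
  have reg: "(\<Sum>t\<in>{1..T}. ip X act par H (\<mu> t) (est t) - ip X act par H \<mu>' (est t))
    \<le> (\<Sum>h\<in>{1..H}. ln (AX X act) / eta h) + (\<Sum>t\<in>{1..T}. stability eta (\<mu> t) (est t))"
  proof -
    have "(\<Sum>t\<in>{1..T}. ip X act par H (\<mu> t) (est t) - ip X act par H \<mu>' (est t))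
      \<le> ftrl_obj X lvl act par H eta (\<lambda>x a. 0) \<mu>' - ftrl_obj X lvl act par H eta (\<lambda>x a. 0) (\<mu> 1)
        + (\<Sum>t\<in>{1..T}. stability eta (\<mu> t) (est t))"
      by (rule ftrl_regret) (use eta est ftrl T mu' in blast)+
    moreover have "ftrl_obj X lvl act par H eta (\<lambda>x a. 0) \<mu>' \<le> 0"
      by (rule regularizer_nonpos) (use eta mu' in blast)+
    moreover have "- (\<Sum>h\<in>{1..H}. ln (AX X act) / eta h) \<le> ftrl_obj X lvl act par H eta (\<lambda>x a. 0) (\<mu> 1)"
      by (rule regularizer_ge) (use eta mu[of 1] T in auto)
    ultimately show ?thesis by linarith
  qed
  \<comment> \<open>One of the two factors \<open>est\<close> is absorbed by
    \<open>rplan * est \<le> 1\<close>, so the second-order term becomes linear in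
    \<open>est\<close>.\<close>
  have "(\<Sum>t\<in>{1..T}. stability eta (\<mu> t) (est t))
    \<le> (\<Sum>t\<in>{1..T}. \<Sum>x\<in>X. \<Sum>a\<in>act x. eta (lvl x) / 2 / ?p x * est t x a)"
    unfolding stability_def
  proof (intro sum_mono)
    fix t x a assume txa: "t \<in> {1..T}" "x \<in> X" "a \<in> act x"
    have p: "0 < ?p x" using pstar_pos txa by blast
    have "eta (lvl x) / 2 * weight (\<mu> t) x a * (est t x a / ?p x)\<^sup>2
       = eta (lvl x) / 2 / ?p x * est t x a * (rplan par H (\<mu> t) x a * est t x a)"
      using p by (simp add: power2_eq_square field_simps)
    also have "\<dots> \<le> eta (lvl x) / 2 / ?p x * est t x a * 1"
      using est1[OF txa] est[OF txa] p eta[OF lvl_range[OF txa(2)]]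
      by (intro mult_left_mono mult_nonneg_nonneg divide_nonneg_nonneg) auto
    finally show "eta (lvl x) / 2 * weight (\<mu> t) x a * (est t x a / ?p x)\<^sup>2
      \<le> eta (lvl x) / 2 / ?p x * est t x a" by simp
  qed
  \<comment> \<open>Being linear, it splits into true losses, controlled by balancedness, and
    excesses, controlled by \<open>over\<close>.\<close>
  also have "\<dots> = (\<Sum>t\<in>{1..T}. \<Sum>x\<in>X. \<Sum>a\<in>act x. eta (lvl x) / 2 / ?p x * ?l t x a)
    + (\<Sum>t\<in>{1..T}. \<Sum>x\<in>X. \<Sum>a\<in>act x. eta (lvl x) / 2 / ?p x * (est t x a - ?l t x a))"
    unfolding sum.distrib[symmetric] by (intro sum.cong refl) (simp add: right_diff_distrib)
  also have "(\<Sum>t\<in>{1..T}. \<Sum>x\<in>X. \<Sum>a\<in>act x. eta (lvl x) / 2 / ?p x * (est t x a - ?l t x a))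
    = (\<Sum>x\<in>X. \<Sum>a\<in>act x. eta (lvl x) / 2 / ?p x * (\<Sum>t\<in>{1..T}. est t x a - ?l t x a))"
    unfolding sum_distrib_left
    by (subst sum.swap, intro sum.cong refl, subst sum.swap) simp
  also have "\<dots> \<le> (\<Sum>x\<in>X. \<Sum>a\<in>act x. eta (lvl x) / 2 * (\<iota> / (2 * gam (lvl x))))"
  proof (intro sum_mono)
    fix x a assume xa: "x \<in> X" "a \<in> act x"
    have p: "0 < ?p x" using pstar_pos xa by blast
    have "eta (lvl x) / 2 / ?p x * (\<Sum>t\<in>{1..T}. est t x a - ?l t x a)
      \<le> eta (lvl x) / 2 / ?p x * (\<iota> / (2 * gam (lvl x)) * ?p x)"
      using over[OF xa] p eta[OF lvl_range[OF xa(1)]] by (intro mult_left_mono) auto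
    also have "\<dots> = eta (lvl x) / 2 * (\<iota> / (2 * gam (lvl x)))" using p by simp
    finally show "eta (lvl x) / 2 / ?p x * (\<Sum>t\<in>{1..T}. est t x a - ?l t x a) \<le> \<dots>" .
  qed
  also have "(\<Sum>t\<in>{1..T}. \<Sum>x\<in>X. \<Sum>a\<in>act x. eta (lvl x) / 2 / ?p x * ?l t x a)
    \<le> (\<Sum>t\<in>{1..T}. \<Sum>h\<in>{1..H}. eta h / 2 * (AX X act / real A ^ (H - h)))"
  proof (rule sum_mono)
    fix t assume t: "t \<in> {1..T}"
    have "(\<Sum>x\<in>X. \<Sum>a\<in>act x. eta (lvl x) / 2 / ?p x * ?l t x a)
      \<le> (\<Sum>x\<in>X. \<Sum>a\<in>act x. eta (lvl x) / 2 * (preach par H (p0 t) (P t) x / ?p x))"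
    proof (intro sum_mono)
      fix x a assume xa: "x \<in> X" "a \<in> act x"
      have "eta (lvl x) / 2 / ?p x * ?l t x a \<le> eta (lvl x) / 2 / ?p x * preach par H (p0 t) (P t) x"
        using pstar_pos[OF xa(1)] eta[OF lvl_range[OF xa(1)]] lossf_bounds[OF tr[OF t] xa(1)] r[OF t xa]
        by (intro mult_left_mono) auto
      then show "eta (lvl x) / 2 / ?p x * ?l t x a
        \<le> eta (lvl x) / 2 * (preach par H (p0 t) (P t) x / ?p x)" by simp
    qed
    also have "\<dots> \<le> (\<Sum>h\<in>{1..H}. eta h / 2 * (AX X act / real A ^ (H - h)))"
      using eta by (intro sum_level_preach_pstar[OF A tr[OF t], where c = "\<lambda>h. eta h / 2"]) (simp add: less_imp_le)
    finally show "(\<Sum>x\<in>X. \<Sum>a\<in>act x. eta (lvl x) / 2 / ?p x * ?l t x a) \<le> \<dots>" .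
  qed
  finally have stab: "(\<Sum>t\<in>{1..T}. stability eta (\<mu> t) (est t))
    \<le> real T * (\<Sum>h\<in>{1..H}. eta h / 2 * (AX X act / real A ^ (H - h)))
      + (\<Sum>x\<in>X. \<Sum>a\<in>act x. eta (lvl x) / 2 * (\<iota> / (2 * gam (lvl x))))" by simp
  show ?thesis
    using bias1 bias2 reg stab under unfolding sum_subtractf by linarith
qed

end

text \<open>The terms are dominated by a geometric series of ratio \<open>1 / sqrt 2\<close>, whose
  limit is \<open>2 + sqrt 2\<close>.\<close>

lemma sum_inverse_sqrt_power:
  assumes "2 \<le> (A::nat)"
  shows "(\<Sum>h\<in>{1..H}. 1 / sqrt (real A ^ (H - h))) \<le> 2 + sqrt 2"
proof -
  define q :: real where "q = 1 / sqrt 2"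
  have q: "0 < q" "q < 1" by (auto simp: q_def)
  have "(\<Sum>h\<in>{1..H}. 1 / sqrt (real A ^ (H - h))) \<le> (\<Sum>h\<in>{1..H}. q ^ (H - h))"
  proof (rule sum_mono)
    fix h
    have "sqrt 2 ^ (H - h) \<le> sqrt (real A) ^ (H - h)" using assms by (intro power_mono) auto
    then have "sqrt 2 ^ (H - h) \<le> sqrt (real A ^ (H - h))" by (simp add: real_sqrt_power)
    then show "1 / sqrt (real A ^ (H - h)) \<le> q ^ (H - h)"
      using assms by (simp add: q_def power_divide) (intro divide_left_mono; simp)
  qed
  also have "\<dots> = (\<Sum>i<H. q ^ i)"
    by (rule sum.reindex_bij_witness[of _ "\<lambda>i. H - i" "\<lambda>h. H - h"]) auto
  also have "\<dots> = (1 - q ^ H) / (1 - q)" using q by (simp add: sum_gp_strict)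
  also have "\<dots> \<le> 1 / (1 - q)" using q by (intro divide_right_mono) auto
  also have "\<dots> = 2 + sqrt 2"
  proof -
    have "(2 + sqrt 2) * (1 - q) = 1" by (simp add: q_def field_simps)
    then show ?thesis using q by (simp add: field_simps)
  qed
  finally show ?thesis .
qed

section \<open>Exponential supermartingales\<close>

text \<open>The hypothesis \<open>step\<close> says that \<open>exp (U t)\<close> has conditional
  mean at most one, in integrated form against bounded test functions. Taking the running product as
  test function keeps its mean at most one, and Markov's inequality follows. The bound
  \<open>B\<close> makes these products bounded.\<close>

lemma (in prob_space) exp_supermartingale_tail:
  fixes U :: "nat \<Rightarrow> 'a \<Rightarrow> real" and T :: nat
  assumes sub: "\<And>t. subalgebra M (F t)"
    and mono: "\<And>s t. s \<le> t \<Longrightarrow> sets (F s) \<subseteq> sets (F t)"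
    and U_meas: "\<And>t. t \<in> {1..T} \<Longrightarrow> U t \<in> borel_measurable (F t)"
    and U_le: "\<And>t \<omega>. t \<in> {1..T} \<Longrightarrow> \<omega> \<in> space M \<Longrightarrow> U t \<omega> \<le> B"
    and step: "\<And>t f C. t \<in> {1..T} \<Longrightarrow> f \<in> borel_measurable (F (t - 1)) \<Longrightarrow>
        (\<And>\<omega>. \<omega> \<in> space M \<Longrightarrow> 0 \<le> f \<omega> \<and> f \<omega> \<le> C) \<Longrightarrow>
        (\<integral>\<omega>. f \<omega> * exp (U t \<omega>) \<partial>M) \<le> (\<integral>\<omega>. f \<omega> \<partial>M)"
  shows "prob {\<omega> \<in> space M. c < (\<Sum>t\<in>{1..T}. U t \<omega>)} \<le> exp (- c)"
proof -
  let ?W = "\<lambda>n \<omega>. exp (\<Sum>t\<in>{1..n}. U t \<omega>)"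
  have sub': "subalgebra (F t) (F s)" if "s \<le> t" for s t
    using mono[OF that] sub[of s] sub[of t] by (simp add: subalgebra_def)
  have W_meas: "?W n \<in> borel_measurable (F n)" if "n \<le> T" for n
    using that by (intro borel_measurable_exp[THEN measurable_compose_rev] borel_measurable_sum
        measurable_from_subalg[OF sub' U_meas]) auto
  have W_le: "0 \<le> ?W n \<omega> \<and> ?W n \<omega> \<le> exp (real n * B)" if "n \<le> T" "\<omega> \<in> space M" for n \<omega>
  proof -
    have "(\<Sum>t\<in>{1..n}. U t \<omega>) \<le> (\<Sum>t\<in>{1..n}. B)" using that by (intro sum_mono U_le) auto
    then show ?thesis by simp
  qed
  have E: "(\<integral>\<omega>. ?W n \<omega> \<partial>M) \<le> 1" if "n \<le> T" for n
    using that
  proof (induction n)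
    case 0
    then show ?case by (simp add: prob_space)
  next
    case (Suc n)
    have "(\<integral>\<omega>. ?W n \<omega> * exp (U (Suc n) \<omega>) \<partial>M) \<le> (\<integral>\<omega>. ?W n \<omega> \<partial>M)"
      using Suc.prems W_meas[of n] W_le[of n] by (intro step[of "Suc n" _ "exp (real n * B)"]) auto
    then show ?case using Suc by (simp add: exp_add)
  qed
  have "?W T \<in> borel_measurable M" using measurable_from_subalg[OF sub W_meas] by blast
  from this have int: "integrable M (?W T)"
    using W_le[of T] by (intro integrable_const_bound[where B = "exp (real T * B)"]) auto
  have "prob {\<omega> \<in> space M. c < (\<Sum>t\<in>{1..T}. U t \<omega>)} \<le> prob {\<omega> \<in> space M. exp c \<le> ?W T \<omega>}"
    using \<open>?W T \<in> borel_measurable M\<close> by (intro finite_measure_mono) (auto simp del: exp_le_cancel_iff)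
  also have "\<dots> \<le> (\<integral>\<omega>. ?W T \<omega> \<partial>M) / exp c"
    by (rule integral_Markov_inequality_measure[OF int sets.empty_sets]) auto
  also have "\<dots> \<le> 1 / exp c" using E[of T] by (intro divide_right_mono) auto
  finally show ?thesis by (simp add: exp_minus field_simps)
qed

lemma (in prob_space) integral_mult_cond_exp:
  fixes f z k :: "'a \<Rightarrow> real"
  assumes sub: "subalgebra M F" and f: "f \<in> borel_measurable F" and z: "z \<in> borel_measurable M"
    and k: "k \<in> borel_measurable M"
    and f_le: "\<And>\<omega>. \<omega> \<in> space M \<Longrightarrow> \<bar>f \<omega>\<bar> \<le> C" and z_le: "\<And>\<omega>. \<omega> \<in> space M \<Longrightarrow> \<bar>z \<omega>\<bar> \<le> D"
    and ce: "AE \<omega> in M. real_cond_exp M F z \<omega> = k \<omega>"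
  shows "(\<integral>\<omega>. f \<omega> * z \<omega> \<partial>M) = (\<integral>\<omega>. f \<omega> * k \<omega> \<partial>M)"
proof -
  interpret finite_measure_subalgebra M F by unfold_locales (rule sub)
  have [measurable]: "f \<in> borel_measurable M" by (rule measurable_from_subalg[OF sub f])
  note [measurable] = z k
  have "\<bar>f \<omega> * z \<omega>\<bar> \<le> C * D" if "\<omega> \<in> space M" for \<omega>
    unfolding abs_mult using f_le[OF that] z_le[OF that] by (intro mult_mono) auto
  then have "integrable M (\<lambda>\<omega>. f \<omega> * z \<omega>)"
    by (intro integrable_const_bound[where B = "C * D"]) auto
  then have "(\<integral>\<omega>. f \<omega> * z \<omega> \<partial>M) = (\<integral>\<omega>. f \<omega> * real_cond_exp M F z \<omega> \<partial>M)"
    using real_cond_exp_intg(2)[of f z] f z by simp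
  also have "\<dots> = (\<integral>\<omega>. f \<omega> * k \<omega> \<partial>M)"
    using ce by (intro integral_cong_AE) auto
  finally show ?thesis .
qed

text \<open>Both sides agree at 0, and the derivative of the difference is
  \<open>x^2 / ((1 + x) * (2 + x)^2)\<close>.\<close>

lemma ln_one_plus_ge:
  fixes y :: real
  assumes "0 \<le> y"
  shows "2 * y / (2 + y) \<le> ln (1 + y)"
proof -
  define \<phi> where "\<phi> = (\<lambda>y::real. ln (1 + y) - 2 * y / (2 + y))"
  have "\<phi> 0 \<le> \<phi> y"
  proof (rule DERIV_nonneg_imp_nondecreasing[OF assms])
    fix x :: real assume x: "0 \<le> x" "x \<le> y"
    have "(\<phi> has_real_derivative 1 / (1 + x) - 4 / (2 + x)\<^sup>2) (at x)"
      unfolding \<phi>_def using x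
      by (auto intro!: derivative_eq_intros simp: field_simps power2_eq_square)
    moreover have "1 / (1 + x) - 4 / (2 + x)\<^sup>2 = x\<^sup>2 / ((1 + x) * (2 + x)\<^sup>2)"
    proof -
      have "1 / (1 + x) - 4 / (2 + x)\<^sup>2 = ((2 + x)\<^sup>2 - 4 * (1 + x)) / ((1 + x) * (2 + x)\<^sup>2)"
        using x by (subst diff_frac_eq) auto
      also have "(2 + x)\<^sup>2 - 4 * (1 + x) = x\<^sup>2" by (simp add: power2_eq_square algebra_simps)
      finally show ?thesis .
    qed
    moreover have "0 \<le> x\<^sup>2 / ((1 + x) * (2 + x)\<^sup>2)" using x by simp
    ultimately show "\<exists>d. (\<phi> has_real_derivative d) (at x) \<and> 0 \<le> d" by metis
  qed
  then show ?thesis by (simp add: \<phi>_def)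
qed

text \<open>Put \<open>y = 2 * g / m\<close> in \<open>ln_one_plus_ge\<close>: its left side becomes
  \<open>2 * g / (m + g)\<close>. This is where adding \<open>g\<close> to the denominator of the
  estimator pays off.\<close>

lemma mult_exp_ix_le:
  fixes m g :: real
  assumes "0 \<le> m" "0 < g"
  shows "(exp (2 * g / (m + g)) - 1) * m \<le> 2 * g"
proof (cases "m = 0")
  case False
  then have m: "0 < m" using assms by simp
  have "2 * g / (m + g) = 2 * (2 * g / m) / (2 + 2 * g / m)"
    using m assms by (simp add: field_simps)
  also have "\<dots> \<le> ln (1 + 2 * g / m)" using ln_one_plus_ge[of "2 * g / m"] m assms by simp
  finally have "exp (2 * g / (m + g)) \<le> exp (ln (1 + 2 * g / m))" by simp
  also have "\<dots> = 1 + 2 * g / m" using m assms by (intro exp_ln) (simp add: add_pos_nonneg)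
  finally have "(exp (2 * g / (m + g)) - 1) * m \<le> (2 * g / m) * m" using m by (intro mult_right_mono) auto
  then show ?thesis using m by simp
qed (use assms in simp)

lemma exp_mult_le:
  fixes y z :: real
  assumes "0 \<le> z" "z \<le> 1"
  shows "exp (z * y) \<le> 1 + z * (exp y - 1)"
  using convex_onD[OF exp_convex assms, of 0 y] by (simp add: algebra_simps)

text \<open>The chord bound \<open>exp_mult_le\<close> makes the integrand affine in
  \<open>z\<close>, so \<open>z\<close> may be replaced by its conditional mean
  \<open>m * l\<close>. By \<open>mult_exp_ix_le\<close> the result is at most
  \<open>1 + 2 * g * l\<close>, which the factor \<open>exp (- 2 * g * l)\<close>
  compensates.\<close>

lemma (in prob_space) ix_step:
  fixes f m l z :: "'a \<Rightarrow> real"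
  assumes sub: "subalgebra M F"
    and meas: "f \<in> borel_measurable F" "m \<in> borel_measurable F" "l \<in> borel_measurable F"
      "z \<in> borel_measurable M"
    and f: "\<And>\<omega>. \<omega> \<in> space M \<Longrightarrow> 0 \<le> f \<omega> \<and> f \<omega> \<le> C"
    and m: "\<And>\<omega>. \<omega> \<in> space M \<Longrightarrow> 0 \<le> m \<omega>" and l: "\<And>\<omega>. \<omega> \<in> space M \<Longrightarrow> 0 \<le> l \<omega>"
    and z: "\<And>\<omega>. \<omega> \<in> space M \<Longrightarrow> 0 \<le> z \<omega> \<and> z \<omega> \<le> 1"
    and g: "0 < g"
    and ce: "AE \<omega> in M. real_cond_exp M F z \<omega> = m \<omega> * l \<omega>"
  shows "(\<integral>\<omega>. f \<omega> * exp (2 * g * (z \<omega> / (m \<omega> + g) - l \<omega>)) \<partial>M) \<le> (\<integral>\<omega>. f \<omega> \<partial>M)"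
proof -
  note [measurable] = meas meas(1-3)[THEN measurable_from_subalg[OF sub]]
  let ?c = "\<lambda>\<omega>. exp (2 * g / (m \<omega> + g)) - 1"
  \<comment> \<open>The compensating factor is measurable with respect to \<open>F\<close> and is
    therefore moved into the test function.\<close>
  let ?f = "\<lambda>\<omega>. f \<omega> * exp (- 2 * g * l \<omega>)"
  have c: "0 \<le> ?c \<omega> \<and> ?c \<omega> \<le> exp 2" if "\<omega> \<in> space M" for \<omega>
  proof -
    have "2 * g / (m \<omega> + g) \<le> 2" using m[OF that] g by (simp add: field_simps)
    then have "exp (2 * g / (m \<omega> + g)) \<le> exp 2" by (simp only: exp_le_cancel_iff)
    moreover have "0 \<le> 2 * g / (m \<omega> + g)" using m[OF that] g by simp
    then have "1 \<le> exp (2 * g / (m \<omega> + g))" by (simp only: one_le_exp_iff)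
    ultimately show ?thesis by linarith
  qed
  have ff: "0 \<le> ?f \<omega> \<and> ?f \<omega> \<le> C" if "\<omega> \<in> space M" for \<omega>
  proof -
    have "exp (- 2 * g * l \<omega>) \<le> 1" using l[OF that] g by simp
    then have "f \<omega> * exp (- 2 * g * l \<omega>) \<le> f \<omega> * 1" using f[OF that] by (intro mult_left_mono) auto
    then show ?thesis using f[OF that] by auto
  qed
  have fc: "\<bar>?f \<omega> * ?c \<omega>\<bar> \<le> C * exp 2" if "\<omega> \<in> space M" for \<omega>
    unfolding abs_mult using ff[OF that] c[OF that] by (intro mult_mono) auto
  have int1: "integrable M ?f"
    using ff by (intro integrable_const_bound[where B = C]) auto
  have int2: "integrable M (\<lambda>\<omega>. ?f \<omega> * ?c \<omega> * z \<omega>)"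
  proof (intro integrable_const_bound[where B = "C * exp 2"] AE_I2)
    fix \<omega> assume w: "\<omega> \<in> space M"
    have "\<bar>?f \<omega> * ?c \<omega>\<bar> * \<bar>z \<omega>\<bar> \<le> C * exp 2 * 1"
      using fc[OF w] z[OF w] by (intro mult_mono) auto
    then show "norm (?f \<omega> * ?c \<omega> * z \<omega>) \<le> C * exp 2" by (simp add: abs_mult)
  qed measurable
  have cml: "?c \<omega> * (m \<omega> * l \<omega>) \<le> 2 * g * l \<omega>" if "\<omega> \<in> space M" for \<omega>
    using mult_right_mono[OF mult_exp_ix_le[OF m[OF that] g] l[OF that]] by (simp add: mult.assoc)
  have le_f: "?f \<omega> + ?f \<omega> * ?c \<omega> * (m \<omega> * l \<omega>) \<le> f \<omega>" if "\<omega> \<in> space M" for \<omega>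
  proof -
    have "?f \<omega> + ?f \<omega> * ?c \<omega> * (m \<omega> * l \<omega>) = ?f \<omega> * (1 + ?c \<omega> * (m \<omega> * l \<omega>))"
      by (simp add: algebra_simps)
    also have "\<dots> \<le> ?f \<omega> * exp (2 * g * l \<omega>)"
      using ff[OF that] cml[OF that] exp_ge_add_one_self[of "2 * g * l \<omega>"]
      by (intro mult_left_mono) linarith+
    also have "\<dots> = f \<omega>" by (simp add: mult.assoc flip: exp_add)
    finally show ?thesis .
  qed
  have int3: "integrable M (\<lambda>\<omega>. ?f \<omega> * ?c \<omega> * (m \<omega> * l \<omega>))"
  proof (intro integrable_const_bound[where B = C] AE_I2)
    fix \<omega> assume w: "\<omega> \<in> space M"
    have "0 \<le> ?f \<omega> * ?c \<omega> * (m \<omega> * l \<omega>)" using ff[OF w] c[OF w] m[OF w] l[OF w] by simp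
    then show "norm (?f \<omega> * ?c \<omega> * (m \<omega> * l \<omega>)) \<le> C" using le_f[OF w] f[OF w] ff[OF w]
      unfolding real_norm_def by linarith
  qed measurable
  have intf: "integrable M f" using f by (intro integrable_const_bound[where B = C]) auto
  have "(\<integral>\<omega>. f \<omega> * exp (2 * g * (z \<omega> / (m \<omega> + g) - l \<omega>)) \<partial>M)
    \<le> (\<integral>\<omega>. ?f \<omega> + ?f \<omega> * ?c \<omega> * z \<omega> \<partial>M)"
  proof (rule integral_mono_AE')
    show "AE \<omega> in M. f \<omega> * exp (2 * g * (z \<omega> / (m \<omega> + g) - l \<omega>)) \<le> ?f \<omega> + ?f \<omega> * ?c \<omega> * z \<omega>"
    proof (rule AE_I2)
      fix \<omega> assume w: "\<omega> \<in> space M"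
      have "f \<omega> * exp (2 * g * (z \<omega> / (m \<omega> + g) - l \<omega>)) = ?f \<omega> * exp (z \<omega> * (2 * g / (m \<omega> + g)))"
        by (simp add: mult.assoc right_diff_distrib mult_ac flip: exp_add)
      also have "\<dots> \<le> ?f \<omega> * (1 + z \<omega> * ?c \<omega>)"
        using ff[OF w] z[OF w] by (intro mult_left_mono exp_mult_le) auto
      finally show "f \<omega> * exp (2 * g * (z \<omega> / (m \<omega> + g) - l \<omega>)) \<le> ?f \<omega> + ?f \<omega> * ?c \<omega> * z \<omega>"
        by (simp add: algebra_simps)
    qed
    show "AE \<omega> in M. 0 \<le> ?f \<omega> + ?f \<omega> * ?c \<omega> * z \<omega>"
      using f c z by (intro AE_I2 add_nonneg_nonneg mult_nonneg_nonneg) auto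
  qed (use int1 int2 in auto)
  also have "\<dots> = (\<integral>\<omega>. ?f \<omega> \<partial>M) + (\<integral>\<omega>. ?f \<omega> * ?c \<omega> * z \<omega> \<partial>M)"
    using int1 int2 by (rule Bochner_Integration.integral_add)
  also have "(\<integral>\<omega>. ?f \<omega> * ?c \<omega> * z \<omega> \<partial>M) = (\<integral>\<omega>. ?f \<omega> * ?c \<omega> * (m \<omega> * l \<omega>) \<partial>M)"
    using fc z by (intro integral_mult_cond_exp[OF sub _ _ _ _ _ ce, of _ "C * exp 2" 1]) auto
  also have "(\<integral>\<omega>. ?f \<omega> \<partial>M) + (\<integral>\<omega>. ?f \<omega> * ?c \<omega> * (m \<omega> * l \<omega>) \<partial>M)
    = (\<integral>\<omega>. ?f \<omega> + ?f \<omega> * ?c \<omega> * (m \<omega> * l \<omega>) \<partial>M)"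
    using int1 int3 by (rule Bochner_Integration.integral_add[symmetric])
  also have "\<dots> \<le> (\<integral>\<omega>. f \<omega> \<partial>M)"
    using int1 int3 intf le_f by (intro integral_mono) auto
  finally show ?thesis .
qed

text \<open>The sum \<open>Y\<close> of the \<open>b i * z i\<close> lies between 0 and
  \<open>K\<close>, so \<open>exp (- c * Y)\<close> is at most
  \<open>1 - c * Y + (c * K)^2 / 2\<close>. Replacing \<open>Y\<close> by its conditional mean and
  using \<open>1 + s \<le> exp s\<close> cancels the factors moved into the test function.\<close>

lemma (in prob_space) azuma_step:
  fixes f :: "'a \<Rightarrow> real" and b z k :: "'i \<Rightarrow> 'a \<Rightarrow> real"
  assumes sub: "subalgebra M F" and I: "finite I"
    and meas: "f \<in> borel_measurable F" "\<And>i. i \<in> I \<Longrightarrow> b i \<in> borel_measurable F"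
      "\<And>i. i \<in> I \<Longrightarrow> k i \<in> borel_measurable F" "\<And>i. i \<in> I \<Longrightarrow> z i \<in> borel_measurable M"
    and f: "\<And>\<omega>. \<omega> \<in> space M \<Longrightarrow> 0 \<le> f \<omega> \<and> f \<omega> \<le> C"
    and b: "\<And>i \<omega>. i \<in> I \<Longrightarrow> \<omega> \<in> space M \<Longrightarrow> 0 \<le> b i \<omega> \<and> b i \<omega> \<le> 1"
    and k: "\<And>i \<omega>. i \<in> I \<Longrightarrow> \<omega> \<in> space M \<Longrightarrow> 0 \<le> k i \<omega> \<and> k i \<omega> \<le> 1"
    and z: "\<And>i \<omega>. i \<in> I \<Longrightarrow> \<omega> \<in> space M \<Longrightarrow> 0 \<le> z i \<omega> \<and> z i \<omega> \<le> 1"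
    and Y: "\<And>\<omega>. \<omega> \<in> space M \<Longrightarrow> (\<Sum>i\<in>I. b i \<omega> * z i \<omega>) \<le> K"
    and c: "0 \<le> c"
    and ce: "\<And>i. i \<in> I \<Longrightarrow> AE \<omega> in M. real_cond_exp M F (z i) \<omega> = k i \<omega>"
  shows "(\<integral>\<omega>. f \<omega> * exp (c * ((\<Sum>i\<in>I. b i \<omega> * k i \<omega>) - (\<Sum>i\<in>I. b i \<omega> * z i \<omega>)) - (c * K)\<^sup>2 / 2) \<partial>M)
    \<le> (\<integral>\<omega>. f \<omega> \<partial>M)"
proof -
  note [measurable] = meas meas(1)[THEN measurable_from_subalg[OF sub]]
    meas(2,3)[THEN measurable_from_subalg[OF sub]]
  let ?m = "\<lambda>\<omega>. \<Sum>i\<in>I. b i \<omega> * k i \<omega>" and ?Y = "\<lambda>\<omega>. \<Sum>i\<in>I. b i \<omega> * z i \<omega>"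
  let ?q = "(c * K)\<^sup>2 / 2"
  let ?f = "\<lambda>\<omega>. f \<omega> * exp (c * ?m \<omega> - ?q)"
  have m: "0 \<le> ?m \<omega> \<and> ?m \<omega> \<le> real (card I)" if "\<omega> \<in> space M" for \<omega>
  proof -
    have "?m \<omega> \<le> (\<Sum>i\<in>I. 1 * 1)" using b k that by (intro sum_mono mult_mono) auto
    then show ?thesis using b k that by (auto intro!: sum_nonneg)
  qed
  have Y0: "0 \<le> ?Y \<omega>" if "\<omega> \<in> space M" for \<omega>
    using b z that by (auto intro!: sum_nonneg)
  have ff: "0 \<le> ?f \<omega> \<and> ?f \<omega> \<le> C * exp (c * real (card I))" if "\<omega> \<in> space M" for \<omega>
  proof -
    have "c * ?m \<omega> \<le> c * real (card I)" using m[OF that] c by (intro mult_left_mono) auto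
    then have "c * ?m \<omega> - ?q \<le> c * real (card I)"
      using zero_le_power2[of "c * K"] by linarith
    then have "exp (c * ?m \<omega> - ?q) \<le> exp (c * real (card I))" by (simp only: exp_le_cancel_iff)
    then have "?f \<omega> \<le> C * exp (c * real (card I))" using f[OF that] by (intro mult_mono) auto
    then show ?thesis using f[OF that] by auto
  qed
  define C' where "C' = C * exp (c * real (card I))"
  have int1: "integrable M ?f"
    using ff by (intro integrable_const_bound[where B = C']) (auto simp: C'_def)
  have bnd: "\<bar>?f \<omega> * b i \<omega>\<bar> \<le> C' * 1" if "\<omega> \<in> space M" "i \<in> I" for \<omega> i
  proof -
    have "\<bar>?f \<omega>\<bar> \<le> C'" "0 \<le> C'" using ff[OF that(1)] unfolding C'_def by linarith+
    moreover have "\<bar>b i \<omega>\<bar> \<le> 1" using b[OF that(2,1)] by linarith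
    ultimately show ?thesis unfolding abs_mult[of "?f \<omega>"] by (intro mult_mono) auto
  qed
  have intz: "integrable M (\<lambda>\<omega>. ?f \<omega> * b i \<omega> * z i \<omega>)" if "i \<in> I" for i
  proof (intro integrable_const_bound[where B = "C' * 1 * 1"] AE_I2)
    show "norm (?f \<omega> * b i \<omega> * z i \<omega>) \<le> C' * 1 * 1" if "\<omega> \<in> space M" for \<omega>
      unfolding real_norm_def abs_mult[of "_ * _" "z i \<omega>"]
      using bnd[OF that \<open>i \<in> I\<close>] z[OF \<open>i \<in> I\<close> that] by (intro mult_mono) auto
  qed (use that in measurable)
  have intk: "integrable M (\<lambda>\<omega>. ?f \<omega> * b i \<omega> * k i \<omega>)" if "i \<in> I" for i
  proof (intro integrable_const_bound[where B = "C' * 1 * 1"] AE_I2)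
    show "norm (?f \<omega> * b i \<omega> * k i \<omega>) \<le> C' * 1 * 1" if "\<omega> \<in> space M" for \<omega>
      unfolding real_norm_def abs_mult[of "_ * _" "k i \<omega>"]
      using bnd[OF that \<open>i \<in> I\<close>] k[OF \<open>i \<in> I\<close> that] by (intro mult_mono) auto
  qed (use that in measurable)
  have eqY: "?f \<omega> * ?Y \<omega> = (\<Sum>i\<in>I. ?f \<omega> * b i \<omega> * z i \<omega>)" for \<omega>
    by (simp add: sum_distrib_left mult.assoc)
  have eqm: "?f \<omega> * ?m \<omega> = (\<Sum>i\<in>I. ?f \<omega> * b i \<omega> * k i \<omega>)" for \<omega>
    by (simp add: sum_distrib_left mult.assoc)
  have intY: "integrable M (\<lambda>\<omega>. ?f \<omega> * ?Y \<omega>)" unfolding eqY using intz by simp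
  have intm: "integrable M (\<lambda>\<omega>. ?f \<omega> * ?m \<omega>)" unfolding eqm using intk by simp
  \<comment> \<open>The conditional mean is known for each \<open>z i\<close> separately, hence the
    exchange is made term by term.\<close>
  have Ym: "(\<integral>\<omega>. ?f \<omega> * ?Y \<omega> \<partial>M) = (\<integral>\<omega>. ?f \<omega> * ?m \<omega> \<partial>M)"
    unfolding eqY eqm
  proof (subst (1 2) Bochner_Integration.integral_sum)
    show "(\<Sum>i\<in>I. \<integral>\<omega>. ?f \<omega> * b i \<omega> * z i \<omega> \<partial>M) = (\<Sum>i\<in>I. \<integral>\<omega>. ?f \<omega> * b i \<omega> * k i \<omega> \<partial>M)"
    proof (rule sum.cong)
      fix i assume i: "i \<in> I"
      note [measurable] = meas(2-4)[OF i] meas(3)[OF i, THEN measurable_from_subalg[OF sub]]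
      show "(\<integral>\<omega>. ?f \<omega> * b i \<omega> * z i \<omega> \<partial>M) = (\<integral>\<omega>. ?f \<omega> * b i \<omega> * k i \<omega> \<partial>M)"
        using bnd[OF _ i] z[OF i] by (intro integral_mult_cond_exp[OF sub _ _ _ _ _ ce[OF i], of _ "C' * 1" 1]) auto
    qed simp
  qed (use intz intk in auto)
  have intf: "integrable M f" using f by (intro integrable_const_bound[where B = C]) auto
  have "(\<integral>\<omega>. f \<omega> * exp (c * (?m \<omega> - ?Y \<omega>) - ?q) \<partial>M)
    \<le> (\<integral>\<omega>. (1 + ?q) * ?f \<omega> - c * (?f \<omega> * ?Y \<omega>) \<partial>M)"
  proof (rule integral_mono_AE')
    have le: "f \<omega> * exp (c * (?m \<omega> - ?Y \<omega>) - ?q) \<le> (1 + ?q) * ?f \<omega> - c * (?f \<omega> * ?Y \<omega>)"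
      if w: "\<omega> \<in> space M" for \<omega>
    proof -
      have "f \<omega> * exp (c * (?m \<omega> - ?Y \<omega>) - ?q) = ?f \<omega> * exp (- (c * ?Y \<omega>))"
        by (simp add: mult.assoc right_diff_distrib flip: exp_add)
      also have "\<dots> \<le> ?f \<omega> * (1 - c * ?Y \<omega> + ?q)"
      proof (rule mult_left_mono)
        have "exp (- (c * ?Y \<omega>)) \<le> 1 - c * ?Y \<omega> + (c * ?Y \<omega>)\<^sup>2 / 2"
          using c Y0[OF w] by (intro exp_minus_le_quadratic) auto
        also have "(c * ?Y \<omega>)\<^sup>2 \<le> (c * K)\<^sup>2"
          using c Y0[OF w] Y[OF w] by (intro power_mono mult_left_mono) auto
        finally show "exp (- (c * ?Y \<omega>)) \<le> 1 - c * ?Y \<omega> + ?q" by simp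
      qed (use ff[OF w] in auto)
      finally show ?thesis by (simp add: algebra_simps)
    qed
    then show "AE \<omega> in M. f \<omega> * exp (c * (?m \<omega> - ?Y \<omega>) - ?q) \<le> (1 + ?q) * ?f \<omega> - c * (?f \<omega> * ?Y \<omega>)"
      by (rule AE_I2)
    \<comment> \<open>The comparison rule asks for integrability of the majorant only, together with
      its nonnegativity.\<close>
    have "0 \<le> (1 + ?q) * ?f \<omega> - c * (?f \<omega> * ?Y \<omega>)" if w: "\<omega> \<in> space M" for \<omega>
    proof -
      have "0 \<le> f \<omega> * exp (c * (?m \<omega> - ?Y \<omega>) - ?q)" using f[OF w] by simp
      then show ?thesis using le[OF w] by linarith
    qed
    then show "AE \<omega> in M. 0 \<le> (1 + ?q) * ?f \<omega> - c * (?f \<omega> * ?Y \<omega>)" by (rule AE_I2)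
    show "integrable M (\<lambda>\<omega>. (1 + ?q) * ?f \<omega> - c * (?f \<omega> * ?Y \<omega>))"
      using int1 intY by (intro Bochner_Integration.integrable_diff integrable_mult_right)
  qed
  also have "\<dots> = (1 + ?q) * (\<integral>\<omega>. ?f \<omega> \<partial>M) - c * (\<integral>\<omega>. ?f \<omega> * ?m \<omega> \<partial>M)"
    using int1 intY by (simp only: Ym[symmetric] Bochner_Integration.integral_diff integrable_mult_right
        integral_mult_right_zero)
  also have "\<dots> = (\<integral>\<omega>. (1 + ?q) * ?f \<omega> - c * (?f \<omega> * ?m \<omega>) \<partial>M)"
    using int1 intm by (simp only: Bochner_Integration.integral_diff integrable_mult_right
        integral_mult_right_zero)
  also have "\<dots> \<le> (\<integral>\<omega>. f \<omega> \<partial>M)"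
  proof (rule integral_mono)
    fix \<omega> assume w: "\<omega> \<in> space M"
    have "(1 + ?q) * ?f \<omega> - c * (?f \<omega> * ?m \<omega>) = ?f \<omega> * (1 + (?q - c * ?m \<omega>))"
      by (simp add: algebra_simps)
    also have "\<dots> \<le> ?f \<omega> * exp (?q - c * ?m \<omega>)"
      using ff[OF w] by (intro mult_left_mono exp_ge_add_one_self) auto
    also have "\<dots> = f \<omega>" by (simp add: mult.assoc flip: exp_add)
    finally show "(1 + ?q) * ?f \<omega> - c * (?f \<omega> * ?m \<omega>) \<le> f \<omega>" .
  qed (use int1 intm intf in auto)
  finally show ?thesis .
qed

section \<open>Measurability of plans and losses, and bounds for a single episode\<close>

context info_tree
begin

lemma borel_measurable_cprod:
  assumes "\<And>x. x \<in> X \<Longrightarrow> (\<lambda>\<omega>. r0 \<omega> x) \<in> borel_measurable G"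
    and "\<And>x y b. x \<in> X \<Longrightarrow> y \<in> X \<Longrightarrow> b \<in> act y \<Longrightarrow> (\<lambda>\<omega>. st \<omega> x y b) \<in> borel_measurable G"
    and "x \<in> X"
  shows "(\<lambda>\<omega>. cprod par (r0 \<omega>) (st \<omega>) H x) \<in> borel_measurable G"
  using assms(3)
proof (induction x rule: tree_induct)
  case (root x)
  then show ?case using assms(1) by (simp add: cprod_root)
next
  case (child x y b)
  then show ?case using assms(2)[of x y b] by (simp add: cprod_child)
qed

lemma borel_measurable_rplan:
  assumes "\<And>x a. x \<in> X \<Longrightarrow> a \<in> act x \<Longrightarrow> (\<lambda>\<omega>. \<mu> \<omega> x a) \<in> borel_measurable G"
    and "x \<in> X" "a \<in> act x"
  shows "(\<lambda>\<omega>. rplan par H (\<mu> \<omega>) x a) \<in> borel_measurable G"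
  unfolding rplan_def using assms by (intro borel_measurable_times borel_measurable_cprod) auto

lemma borel_measurable_lossf:
  assumes "\<And>x. x \<in> X \<Longrightarrow> (\<lambda>\<omega>. p0 \<omega> x) \<in> borel_measurable G"
    and "\<And>x y b. x \<in> X \<Longrightarrow> y \<in> X \<Longrightarrow> b \<in> act y \<Longrightarrow> (\<lambda>\<omega>. P \<omega> y b x) \<in> borel_measurable G"
    and "x \<in> X" "(\<lambda>\<omega>. r \<omega> x a) \<in> borel_measurable G"
  shows "(\<lambda>\<omega>. lossf par H (p0 \<omega>) (P \<omega>) (r \<omega>) x a) \<in> borel_measurable G"
  unfolding lossf_def preach_def using assms
  by (intro borel_measurable_times borel_measurable_diff borel_measurable_cprod) auto

lemma rplan_lossf_le_1:
  assumes tr: "transition p0 P" and mu: "\<mu> \<in> policies X act" and xa: "x \<in> X" "a \<in> act x"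
    and r: "0 \<le> r x a" "r x a \<le> 1"
  shows "rplan par H \<mu> x a * lossf par H p0 P r x a \<le> 1"
proof -
  let ?v = "\<lambda>x a. preach par H p0 P x * rplan par H \<mu> x a"
  have v: "0 \<le> ?v x a" if "x \<in> X" "a \<in> act x" for x a
    using preach_nonneg[OF tr that(1)] rplan_nonneg[OF mu that] by simp
  have "rplan par H \<mu> x a * lossf par H p0 P r x a \<le> rplan par H \<mu> x a * preach par H p0 P x"
    using rplan_nonneg[OF mu xa] lossf_bounds[of p0 P x r a] tr xa r by (intro mult_left_mono) auto
  also have "\<dots> = ?v x a" by (rule mult.commute)
  also have "\<dots> \<le> (\<Sum>a\<in>act x. ?v x a)"
    using xa v finite_act by (intro member_le_sum) auto
  also have "\<dots> \<le> (\<Sum>x'\<in>level (lvl x). \<Sum>a\<in>act x'. ?v x' a)"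
    using xa v by (intro member_le_sum[where f = "\<lambda>x'. \<Sum>a\<in>act x'. ?v x' a"] sum_nonneg) auto
  also have "\<dots> = 1" by (rule sum_preach_rplan[OF tr mu lvl_range[OF xa(1)]])
  finally show ?thesis .
qed

text \<open>A trajectory marks at most one pair per level; none is marked at a level where the
  observed pair lies outside the tree.\<close>

lemma sum_visits_le:
  "(\<Sum>x\<in>X. \<Sum>a\<in>act x. if xo (lvl x) = x \<and> ao (lvl x) = a then 1 else 0) \<le> real H"
proof -
  have "(\<Sum>x\<in>level h. \<Sum>a\<in>act x. if xo (lvl x) = x \<and> ao (lvl x) = a then 1 else 0) \<le> (1::real)" for h
  proof -
    have "(\<Sum>x\<in>level h. \<Sum>a\<in>act x. if xo (lvl x) = x \<and> ao (lvl x) = a then 1 else 0)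
      \<le> (\<Sum>x\<in>level h. if x = xo h then 1 else (0::real))"
    proof (rule sum_mono)
      fix x assume x: "x \<in> level h"
      have "(\<Sum>a\<in>act x. if xo h = x \<and> ao h = a then 1 else (0::real))
         = (if xo h = x then (\<Sum>a\<in>act x. if ao h = a then 1 else 0) else 0)" by auto
      also have "\<dots> \<le> (if x = xo h then 1 else 0)"
        using finite_act[of x] x by (auto simp: sum.delta')
      finally show "(\<Sum>a\<in>act x. if xo (lvl x) = x \<and> ao (lvl x) = a then 1 else 0)
        \<le> (if x = xo h then 1 else (0::real))" using x by simp
    qed
    also have "\<dots> \<le> 1" by (simp add: sum.delta)
    finally show ?thesis .
  qed
  then have "(\<Sum>h\<in>{1..H}. \<Sum>x\<in>level h. \<Sum>a\<in>act x. if xo (lvl x) = x \<and> ao (lvl x) = a then 1 else 0)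
     \<le> (\<Sum>h\<in>{1..H}. 1::real)" by (intro sum_mono)
  then show ?thesis by (subst sum_levels) simp
qed

end

section \<open>Tuning\<close>

text \<open>With \<open>S = A ^ (H - h)\<close> and \<open>B = AX * T\<close>, the tuned rates turn
  penalty, stability, deviation and bias into one common expression. Both sides are positive and
  have the square \<open>y * B / (2 * S)\<close>.\<close>

lemma rate_identities:
  fixes y S B :: real
  assumes "0 < y" "0 < S" "0 < B"
  shows "y / sqrt (2 * S * y / B) = sqrt (y * B / 2) * (1 / sqrt S)"
    and "B * (sqrt (2 * S * y / B) / 2 / S) = sqrt (y * B / 2) * (1 / sqrt S)"
    and "y / (2 * sqrt (S * y / (2 * B))) = sqrt (y * B / 2) * (1 / sqrt S)"
    and "B * (sqrt (S * y / (2 * B)) / S) = sqrt (y * B / 2) * (1 / sqrt S)"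
proof -
  have r: "(sqrt (y * B / 2) * (1 / sqrt S))\<^sup>2 = y * B / (2 * S)"
    using assms by (simp add: power_mult_distrib power_divide)
  have 1: "(y / sqrt (2 * S * y / B))\<^sup>2 = y * B / (2 * S)"
    using assms by (simp add: power_divide) (simp add: field_simps power2_eq_square)
  have 2: "(B * (sqrt (2 * S * y / B) / 2 / S))\<^sup>2 = y * B / (2 * S)"
    using assms by (simp add: power_divide power_mult_distrib) (simp add: field_simps power2_eq_square)
  have 3: "(y / (2 * sqrt (S * y / (2 * B))))\<^sup>2 = y * B / (2 * S)"
    using assms by (simp add: power_divide power_mult_distrib) (simp add: field_simps power2_eq_square)
  have 4: "(B * (sqrt (S * y / (2 * B)) / S))\<^sup>2 = y * B / (2 * S)"
    using assms by (simp add: power_divide power_mult_distrib) (simp add: field_simps power2_eq_square)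
  show "y / sqrt (2 * S * y / B) = sqrt (y * B / 2) * (1 / sqrt S)"
    by (rule power2_eq_imp_eq) (use 1 r assms in auto)
  show "B * (sqrt (2 * S * y / B) / 2 / S) = sqrt (y * B / 2) * (1 / sqrt S)"
    by (rule power2_eq_imp_eq) (use 2 r assms in auto)
  show "y / (2 * sqrt (S * y / (2 * B))) = sqrt (y * B / 2) * (1 / sqrt S)"
    by (rule power2_eq_imp_eq) (use 3 r assms in auto)
  show "B * (sqrt (S * y / (2 * B)) / S) = sqrt (y * B / 2) * (1 / sqrt S)"
    by (rule power2_eq_imp_eq) (use 4 r assms in auto)
qed

text \<open>The constant is \<open>(2 + sqrt 2) / sqrt 2 = 1 + sqrt 2\<close>, rounded up to
  5/2.\<close>

lemma sum_rate_le:
  fixes y B :: real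
  assumes "2 \<le> (A::nat)" "0 \<le> y" "0 \<le> B"
  shows "(\<Sum>h\<in>{1..H}. sqrt (y * B / 2) * (1 / sqrt (real A ^ (H - h)))) \<le> 5 / 2 * sqrt y * sqrt B"
proof -
  have s2: "sqrt 2 \<le> 3 / 2" by (rule real_le_lsqrt) (auto simp: power2_eq_square)
  have "(\<Sum>h\<in>{1..H}. sqrt (y * B / 2) * (1 / sqrt (real A ^ (H - h))))
    = sqrt (y * B / 2) * (\<Sum>h\<in>{1..H}. 1 / sqrt (real A ^ (H - h)))"
    by (simp add: sum_distrib_left)
  also have "\<dots> \<le> sqrt (y * B / 2) * (2 + sqrt 2)"
    using assms by (intro mult_left_mono sum_inverse_sqrt_power) auto
  also have "\<dots> = (1 + sqrt 2) * (sqrt y * sqrt B)"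
  proof -
    have "sqrt (y * B / 2) = sqrt y * sqrt B / sqrt 2" by (simp add: real_sqrt_divide real_sqrt_mult)
    moreover have "(2 + sqrt 2) / sqrt 2 = 1 + sqrt 2" by (simp add: field_simps)
    ultimately show ?thesis by (metis times_divide_eq_left times_divide_eq_right mult.commute)
  qed
  also have "\<dots> \<le> 5 / 2 * (sqrt y * sqrt B)" using s2 assms by (intro mult_right_mono) auto
  finally show ?thesis by simp
qed

text \<open>From \<open>n = 3\<close> on, doubling outgrows the step from \<open>n^2\<close> to
  \<open>(n + 1)^2\<close>. The factor 2 is needed at 3, where 9 exceeds 8.\<close>

lemma square_le_double_power: "n\<^sup>2 \<le> 2 * (2::nat) ^ n"
proof (induction n)
  case (Suc n)
  show ?case
  proof (cases "n \<le> 2")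
    case True
    then have "n = 0 \<or> n = 1 \<or> n = 2" by auto
    then show ?thesis by (auto simp: power2_eq_square)
  next
    case False
    then have "3 * n \<le> n * n" by simp
    moreover have "(Suc n)\<^sup>2 = n * n + 2 * n + 1" "n\<^sup>2 = n * n" by (simp_all add: power2_eq_square)
    ultimately have "(Suc n)\<^sup>2 \<le> 2 * n\<^sup>2" using False by linarith
    then show ?thesis using Suc by simp
  qed
qed simp

theorem theorem4:
  fixes X :: "'x set" and lvl :: "'x \<Rightarrow> nat" and act :: "'x \<Rightarrow> 'a set"
    and par :: "'x \<Rightarrow> ('x \<times> 'a) option" and H :: nat and A :: nat and T :: nat
    and \<delta> :: real and \<iota> :: real and gam :: "nat \<Rightarrow> real" and eta :: "nat \<Rightarrow> real"
    and M :: "'w measure" and F :: "nat \<Rightarrow> 'w measure"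
    and P0 :: "nat \<Rightarrow> 'w \<Rightarrow> 'x \<Rightarrow> real" and Ptr :: "nat \<Rightarrow> 'w \<Rightarrow> 'x \<Rightarrow> 'a \<Rightarrow> 'x \<Rightarrow> real"
    and R :: "nat \<Rightarrow> 'w \<Rightarrow> 'x \<Rightarrow> 'a \<Rightarrow> real"
    and xobs :: "nat \<Rightarrow> nat \<Rightarrow> 'w \<Rightarrow> 'x" and aobs :: "nat \<Rightarrow> nat \<Rightarrow> 'w \<Rightarrow> 'a"
    and robs :: "nat \<Rightarrow> nat \<Rightarrow> 'w \<Rightarrow> real"
    and mu :: "nat \<Rightarrow> 'w \<Rightarrow> 'x \<Rightarrow> 'a \<Rightarrow> real"
  assumes tree: "efg_tree X lvl act par H"
    and actA: "\<forall>x\<in>X. card (act x) = A" and A2: "A \<ge> 2"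
    and delta: "0 < \<delta>" "\<delta> < 1"
    and iota: "\<iota> = ln (3 * AX X act / \<delta>)"
    and gam: "\<forall>h. gam h = sqrt (real A ^ (H - h) * \<iota> / (2 * AX X act * real T))"
    and eta: "\<forall>h. eta h = sqrt (2 * real A ^ (H - h) * ln (AX X act) / (AX X act * real T))"
    \<comment> \<open>probability space and filtration\<close>
    and M: "prob_space M"
    and F_sub: "\<forall>t. subalgebra M (F t)"
    and F_mono: "\<forall>s t. s \<le> t \<longrightarrow> sets (F s) \<subseteq> sets (F t)"
    \<comment> \<open>observations of episode t are F_t-measurable; rewards in [0,1]\<close>
    and obs_meas: "\<forall>t\<in>{1..T}. \<forall>h\<in>{1..H}.
         xobs t h \<in> measurable (F t) (count_space UNIV) \<and>
         aobs t h \<in> measurable (F t) (count_space UNIV) \<and>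
         robs t h \<in> borel_measurable (F t)"
    and robs_range: "\<forall>t\<in>{1..T}. \<forall>h\<in>{1..H}. \<forall>\<omega>\<in>space M. 0 \<le> robs t h \<omega> \<and> robs t h \<omega> \<le> 1"
    \<comment> \<open>opponent nu^t: induced p_0, p_h, r_h, F_{t-1}-measurable\<close>
    and opp_valid: "\<forall>t\<in>{1..T}. \<forall>\<omega>\<in>space M.
         (\<forall>x\<in>X. lvl x = 1 \<longrightarrow> 0 \<le> P0 t \<omega> x) \<and> (\<Sum>x\<in>{x\<in>X. lvl x = 1}. P0 t \<omega> x) = 1 \<and>
         (\<forall>y\<in>X. \<forall>b\<in>act y. lvl y < H \<longrightarrow>
             (\<forall>x\<in>children X par y b. 0 \<le> Ptr t \<omega> y b x) \<and>
             (\<Sum>x\<in>children X par y b. Ptr t \<omega> y b x) = 1) \<and>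
         (\<forall>x\<in>X. \<forall>a\<in>act x. 0 \<le> R t \<omega> x a \<and> R t \<omega> x a \<le> 1)"
    and opp_meas: "\<forall>t\<in>{1..T}.
         (\<forall>x\<in>X. (\<lambda>\<omega>. P0 t \<omega> x) \<in> borel_measurable (F (t - 1))) \<and>
         (\<forall>y\<in>X. \<forall>b\<in>act y. \<forall>x\<in>X. (\<lambda>\<omega>. Ptr t \<omega> y b x) \<in> borel_measurable (F (t - 1))) \<and>
         (\<forall>x\<in>X. \<forall>a\<in>act x. (\<lambda>\<omega>. R t \<omega> x a) \<in> borel_measurable (F (t - 1)))"
    \<comment> \<open>mu^t is F_{t-1}-measurable and is a Balanced-FTRL (Shannon) minimizer\<close>
    and mu_meas: "\<forall>t\<in>{1..T}. \<forall>x\<in>X. \<forall>a\<in>act x. (\<lambda>\<omega>. mu t \<omega> x a) \<in> borel_measurable (F (t - 1))"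
    and mu_ftrl: "\<forall>t\<in>{1..T}. \<forall>\<omega>\<in>space M.
         mu t \<omega> \<in> policies X act \<and>
         (\<forall>\<mu>'\<in>policies X act.
            ftrl_obj X lvl act par H eta
              (\<lambda>x a. \<Sum>k\<in>{1..<t}. ix_est X lvl act par H gam (mu k \<omega>)
                        (\<lambda>h. xobs k h \<omega>) (\<lambda>h. aobs k h \<omega>) (\<lambda>h. robs k h \<omega>) x a) (mu t \<omega>)
            \<le> ftrl_obj X lvl act par H eta
              (\<lambda>x a. \<Sum>k\<in>{1..<t}. ix_est X lvl act par H gam (mu k \<omega>)
                        (\<lambda>h. xobs k h \<omega>) (\<lambda>h. aobs k h \<omega>) (\<lambda>h. robs k h \<omega>) x a) \<mu>')"
    \<comment> \<open>conditional law of the trajectory given F_{t-1}\<close>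
    and law: "\<forall>t\<in>{1..T}. \<forall>x\<in>X. \<forall>a\<in>act x.
         (AE \<omega> in M. real_cond_exp M (F (t - 1))
             (\<lambda>\<omega>. if xobs t (lvl x) \<omega> = x \<and> aobs t (lvl x) \<omega> = a then 1 else 0) \<omega>
           = preach par H (P0 t \<omega>) (Ptr t \<omega>) x * rplan par H (mu t \<omega>) x a) \<and>
         (AE \<omega> in M. real_cond_exp M (F (t - 1))
             (\<lambda>\<omega>. (if xobs t (lvl x) \<omega> = x \<and> aobs t (lvl x) \<omega> = a then 1 else 0)
                   * (1 - robs t (lvl x) \<omega>)) \<omega>
           = rplan par H (mu t \<omega>) x a * lossf par H (P0 t \<omega>) (Ptr t \<omega>) (R t \<omega>) x a)"
  shows "\<exists>E\<in>sets M. measure M E \<ge> 1 - \<delta> \<and>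
           (\<forall>\<omega>\<in>E.
              (SUP \<mu>'\<in>policies X act.
                 \<Sum>t\<in>{1..T}. ip X act par H (mu t \<omega>) (lossf par H (P0 t \<omega>) (Ptr t \<omega>) (R t \<omega>))
                             - ip X act par H \<mu>' (lossf par H (P0 t \<omega>) (Ptr t \<omega>) (R t \<omega>)))
              \<le> (5 * sqrt (ln (AX X act)) + 8 * \<iota>) * sqrt (AX X act * real T))"
proof -
  interpret info_tree X lvl act par H by unfold_locales (rule tree)
  interpret prob_space M by (rule M)
  let ?N = "AX X act" and ?p = "pstar X act par H"
  let ?l = "\<lambda>t \<omega>. lossf par H (P0 t \<omega>) (Ptr t \<omega>) (R t \<omega>)"
  let ?reg = "\<lambda>\<omega> \<mu>'. \<Sum>t\<in>{1..T}. ip X act par H (mu t \<omega>) (?l t \<omega>) - ip X act par H \<mu>' (?l t \<omega>)"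
  let ?bound = "(5 * sqrt (ln ?N) + 8 * \<iota>) * sqrt (?N * real T)"

  \<comment> \<open>Size of the game and of the confidence parameter\<close>
  have N_pow: "2 ^ H \<le> ?N"
  proof -
    have "(2::real) ^ H \<le> real A ^ H" using A2 by (intro power_mono) auto
    then show ?thesis using AX_ge_power[OF actA] by simp
  qed
  have N2: "2 \<le> ?N"
  proof -
    have "(2::real) ^ 1 \<le> 2 ^ H" using H_pos by (intro power_increasing) auto
    then show ?thesis using N_pow by simp
  qed
  have lnN: "0 < ln ?N" using N2 by simp
  have exp_iota: "exp (- \<iota>) = \<delta> / (3 * ?N)"
    unfolding iota using delta N2 by (simp add: exp_minus field_simps)
  have iota_lnN: "ln ?N \<le> \<iota>"
    unfolding iota using delta N2 by (intro ln_mono) (auto simp: field_simps)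
  \<comment> \<open>The 3 in \<open>\<iota>\<close> exceeds Euler's number; so
    \<open>\<iota>\<close> is at least 1, and later
    \<open>sqrt \<iota> \<le> \<iota>\<close>.\<close>
  have iota1: "1 \<le> \<iota>"
  proof -
    have "exp 1 \<le> (3::real)" using exp_le by simp
    also have "\<dots> \<le> 3 * ?N / \<delta>" using delta N2 by (simp add: field_simps)
    finally show ?thesis unfolding iota using delta N2 by (subst ln_ge_iff) auto
  qed
  have tr: "transition (P0 t \<omega>) (Ptr t \<omega>)" if "t \<in> {1..T}" "\<omega> \<in> space M" for t \<omega>
    using opp_valid that unfolding transition_def by auto
  have pol: "mu t \<omega> \<in> policies X act" if "t \<in> {1..T}" "\<omega> \<in> space M" for t \<omega>
    using mu_ftrl that by blast
  have Rr: "0 \<le> R t \<omega> x a \<and> R t \<omega> x a \<le> 1"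
    if "t \<in> {1..T}" "\<omega> \<in> space M" "x \<in> X" "a \<in> act x" for t \<omega> x a
    using opp_valid that by blast
  show ?thesis
  proof (cases "real T \<le> ?N")

    \<comment> \<open>Few episodes: the trivial bound on the whole space\<close>
    case True
    \<comment> \<open>From \<open>2 ^ H \<le> ?N\<close> and \<open>ln 2 \<ge> 2/3\<close>, the
      horizon is at most \<open>3/2 * \<iota>\<close>. Since \<open>T \<le> ?N\<close>, also
      \<open>T \<le> sqrt (?N * T)\<close>.\<close>
    have HI: "real H \<le> 8 * \<iota>"
    proof -
      have "real H * (2/3) \<le> real H * ln 2" using ln2_ge_two_thirds by (intro mult_left_mono) auto
      also have "\<dots> = ln (2 ^ H)" by (simp add: ln_realpow)
      also have "\<dots> \<le> ln ?N" using N_pow N2 by (subst ln_le_cancel_iff) auto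
      finally show ?thesis using iota_lnN iota1 by linarith
    qed
    have "?reg \<omega> \<mu>' \<le> ?bound" if w: "\<omega> \<in> space M" and mu': "\<mu>' \<in> policies X act" for \<omega> \<mu>'
    proof -
      have "?reg \<omega> \<mu>' \<le> (\<Sum>t\<in>{1..T}. real H)"
      proof (rule sum_mono)
        fix t assume t: "t \<in> {1..T}"
        have "ip X act par H (mu t \<omega>) (?l t \<omega>) \<le> real H"
          using ip_lossf_bounds(2)[OF tr[OF t w] pol[OF t w]] Rr[OF t w] by blast
        moreover have "0 \<le> ip X act par H \<mu>' (?l t \<omega>)"
          using ip_lossf_bounds(1)[OF tr[OF t w] mu'] Rr[OF t w] by blast
        ultimately show "ip X act par H (mu t \<omega>) (?l t \<omega>) - ip X act par H \<mu>' (?l t \<omega>) \<le> real H"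
          by linarith
      qed
      also have "\<dots> = real H * real T" by simp
      also have "\<dots> \<le> 8 * \<iota> * sqrt (?N * real T)"
      proof (rule mult_mono[OF HI])
        have "real T = sqrt (real T * real T)" by simp
        also have "\<dots> \<le> sqrt (?N * real T)" using True by (intro real_sqrt_le_mono mult_right_mono) auto
        finally show "real T \<le> sqrt (?N * real T)" .
      qed (use iota1 in auto)
      also have "\<dots> \<le> ?bound" using lnN N2 by (intro mult_right_mono) auto
      finally show ?thesis .
    qed
    then show ?thesis
      using policies_nonempty delta by (intro bexI[of _ "space M"]) (auto simp: prob_space intro!: cSUP_least)
  next

    \<comment> \<open>Many episodes: the estimator and its pointwise bounds\<close>
    case False
    then have NT: "?N \<le> real T" by simp
    \<comment> \<open>For \<open>T = 0\<close> the rates would be zero through division by zero;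
      that value falls under the other case.\<close>
    then have T1: "1 \<le> T" using N2 by linarith
    define B where "B = ?N * real T"
    have B: "0 < B" using N2 T1 by (simp add: B_def)
    have gam': "gam h = sqrt (real A ^ (H - h) * \<iota> / (2 * B))" for h
      using gam by (simp add: B_def mult.assoc)
    have eta': "eta h = sqrt (2 * real A ^ (H - h) * ln ?N / B)" for h
      using eta by (simp add: B_def)
    have gam_pos: "0 < gam h" for h unfolding gam' using A2 B iota1 by simp
    have eta_pos: "0 < eta h" for h unfolding eta' using A2 B lnN by simp
    define m where "m = (\<lambda>t \<omega> x a. rplan par H (mu t \<omega>) x a)"
    define g where "g = (\<lambda>x. gam (lvl x) / ?p x)"
    define z where "z = (\<lambda>t x a \<omega>. (if xobs t (lvl x) \<omega> = x \<and> aobs t (lvl x) \<omega> = a then 1 else 0)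
                   * (1 - robs t (lvl x) \<omega>))"
    define est where "est = (\<lambda>t \<omega>. ix_est X lvl act par H gam (mu t \<omega>)
                        (\<lambda>h. xobs t h \<omega>) (\<lambda>h. aobs t h \<omega>) (\<lambda>h. robs t h \<omega>))"
    have est_eq: "est t \<omega> x a = z t x a \<omega> / (m t \<omega> x a + g x)" for t \<omega> x a
      by (simp add: est_def ix_est_def z_def m_def g_def)
    have g_pos: "0 < g x" if "x \<in> X" for x using gam_pos pstar_pos[OF that] by (simp add: g_def)
    have m0: "0 \<le> m t \<omega> x a" if "t \<in> {1..T}" "\<omega> \<in> space M" "x \<in> X" "a \<in> act x" for t \<omega> x a
      using rplan_nonneg[OF pol] that by (simp add: m_def)
    have z01: "0 \<le> z t x a \<omega> \<and> z t x a \<omega> \<le> (if xobs t (lvl x) \<omega> = x \<and> aobs t (lvl x) \<omega> = a then 1 else 0)"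
      if "t \<in> {1..T}" "\<omega> \<in> space M" "x \<in> X" for t \<omega> x a
      using robs_range lvl_range[OF that(3)] that by (auto simp: z_def)
    then have z1: "0 \<le> z t x a \<omega> \<and> z t x a \<omega> \<le> 1"
      if "t \<in> {1..T}" "\<omega> \<in> space M" "x \<in> X" for t \<omega> x a
      using z01[OF that, of a] by (auto split: if_splits)
    have l0: "0 \<le> ?l t \<omega> x a" if "t \<in> {1..T}" "\<omega> \<in> space M" "x \<in> X" "a \<in> act x" for t \<omega> x a
      using lossf_bounds(1)[OF tr] Rr that by blast
    have est0: "0 \<le> est t \<omega> x a" if "t \<in> {1..T}" "\<omega> \<in> space M" "x \<in> X" "a \<in> act x" for t \<omega> x a
      using z1[OF that(1-3), of a] m0[OF that] g_pos[OF that(3)] by (simp add: est_eq)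
    have est_le: "g x * est t \<omega> x a \<le> 1" if "t \<in> {1..T}" "\<omega> \<in> space M" "x \<in> X" "a \<in> act x" for t \<omega> x a
    proof -
      have "g x * z t x a \<omega> \<le> g x * 1"
        using z1[OF that(1-3), of a] g_pos[OF that(3)] by (intro mult_left_mono) auto
      then have "g x * z t x a \<omega> \<le> m t \<omega> x a + g x" using m0[OF that] by linarith
      then show ?thesis using m0[OF that] g_pos[OF that(3)] by (simp add: est_eq)
    qed
    have mest_le: "m t \<omega> x a * est t \<omega> x a \<le> 1"
      if "t \<in> {1..T}" "\<omega> \<in> space M" "x \<in> X" "a \<in> act x" for t \<omega> x a
    proof -
      have "m t \<omega> x a * z t x a \<omega> \<le> m t \<omega> x a * 1"
        using z1[OF that(1-3), of a] m0[OF that] by (intro mult_left_mono) auto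
      then have "m t \<omega> x a * z t x a \<omega> \<le> m t \<omega> x a + g x" using g_pos[OF that(3)] by linarith
      then show ?thesis using m0[OF that] g_pos[OF that(3)] by (simp add: est_eq)
    qed

    \<comment> \<open>Measurability and conditional means\<close>
    have sub: "subalgebra M (F t)" for t using F_sub by blast
    have sub': "subalgebra (F t) (F (t - 1))" for t
      using F_mono sub[of t] sub[of "t - 1"] by (simp add: subalgebra_def)
    have m_meas: "(\<lambda>\<omega>. m t \<omega> x a) \<in> borel_measurable (F (t - 1))"
      if "t \<in> {1..T}" "x \<in> X" "a \<in> act x" for t x a
      unfolding m_def using mu_meas that by (intro borel_measurable_rplan) auto
    have l_meas: "(\<lambda>\<omega>. ?l t \<omega> x a) \<in> borel_measurable (F (t - 1))"
      if "t \<in> {1..T}" "x \<in> X" "a \<in> act x" for t x a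
      using opp_meas that by (intro borel_measurable_lossf) auto
    have z_meas: "z t x a \<in> borel_measurable (F t)" if "t \<in> {1..T}" "x \<in> X" for t x a
    proof -
      have [measurable]: "xobs t (lvl x) \<in> measurable (F t) (count_space UNIV)"
        "aobs t (lvl x) \<in> measurable (F t) (count_space UNIV)" "robs t (lvl x) \<in> borel_measurable (F t)"
        using obs_meas that lvl_range[OF that(2)] by auto
      show ?thesis unfolding z_def by measurable
    qed
    have est_meas: "(\<lambda>\<omega>. est t \<omega> x a) \<in> borel_measurable (F t)"
      if "t \<in> {1..T}" "x \<in> X" "a \<in> act x" for t x a
      unfolding est_eq using z_meas[OF that(1,2)] measurable_from_subalg[OF sub' m_meas[OF that]] by simp
    have ce: "AE \<omega> in M. real_cond_exp M (F (t - 1)) (z t x a) \<omega> = m t \<omega> x a * ?l t \<omega> x a"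
      if "t \<in> {1..T}" "x \<in> X" "a \<in> act x" for t x a
      using law that unfolding z_def m_def by blast

    \<comment> \<open>Overestimation at a single pair\<close>
    define bad where "bad = (\<lambda>(x, a). {\<omega> \<in> space M. \<iota> < (\<Sum>t\<in>{1..T}. 2 * g x * (est t \<omega> x a - ?l t \<omega> x a))})"
    have bad_meas: "bad (x, a) \<in> sets M" and bad_prob: "prob (bad (x, a)) \<le> exp (- \<iota>)"
      if xa: "x \<in> X" "a \<in> act x" for x a
    proof -
      have U_meas: "(\<lambda>\<omega>. 2 * g x * (est t \<omega> x a - ?l t \<omega> x a)) \<in> borel_measurable (F t)"
        if "t \<in> {1..T}" for t
        using est_meas[OF that xa] measurable_from_subalg[OF sub' l_meas[OF that xa]] by simp
      have "(\<lambda>\<omega>. \<Sum>t\<in>{1..T}. 2 * g x * (est t \<omega> x a - ?l t \<omega> x a)) \<in> borel_measurable M"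
        using measurable_from_subalg[OF sub U_meas] by (intro borel_measurable_sum)
      then show "bad (x, a) \<in> sets M" unfolding bad_def by simp
      show "prob (bad (x, a)) \<le> exp (- \<iota>)"
        unfolding bad_def prod.case
      proof (rule exp_supermartingale_tail[where F = F and B = 2])
        show "2 * g x * (est t \<omega> x a - ?l t \<omega> x a) \<le> 2" if "t \<in> {1..T}" "\<omega> \<in> space M" for t \<omega>
        proof -
          have "0 \<le> g x * ?l t \<omega> x a" using g_pos[OF xa(1)] l0[OF that xa] by simp
          then show ?thesis using est_le[OF that xa] by (simp add: right_diff_distrib)
        qed
        fix t and f :: "'w \<Rightarrow> real" and C :: real
        assume t: "t \<in> {1..T}" and f: "f \<in> borel_measurable (F (t - 1))"
          "\<And>\<omega>. \<omega> \<in> space M \<Longrightarrow> 0 \<le> f \<omega> \<and> f \<omega> \<le> C"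
        show "(\<integral>\<omega>. f \<omega> * exp (2 * g x * (est t \<omega> x a - ?l t \<omega> x a)) \<partial>M) \<le> (\<integral>\<omega>. f \<omega> \<partial>M)"
          unfolding est_eq
          by (rule ix_step[OF sub f(1) m_meas[OF t xa] l_meas[OF t xa]
                measurable_from_subalg[OF sub z_meas[OF t xa(1)]] f(2) m0[OF t _ xa] l0[OF t _ xa]
                z1[OF t _ xa(1)] g_pos[OF xa(1)] ce[OF t xa]])
      qed (use sub F_mono U_meas in auto)
    qed

    \<comment> \<open>Underestimation of the learner's estimated loss\<close>
    define I where "I = Sigma X act"
    have finI: "finite I" using finite_act by (auto simp: I_def)
    define b where "b = (\<lambda>t (x, a) \<omega>. m t \<omega> x a / (m t \<omega> x a + g x))"
    define k where "k = (\<lambda>t (x, a) \<omega>. m t \<omega> x a * ?l t \<omega> x a)"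
    define zz where "zz = (\<lambda>t (x, a). z t x a)"
    have mean_eq: "ix_mean gam (mu t \<omega>) (?l t \<omega>) = (\<Sum>i\<in>I. b t i \<omega> * k t i \<omega>)" for t \<omega>
      unfolding ix_mean_def I_def b_def k_def m_def g_def
      by (subst sum.Sigma) (use finite_act in \<open>auto simp: case_prod_beta\<close>)
    have ip_eq: "ip X act par H (mu t \<omega>) (est t \<omega>) = (\<Sum>i\<in>I. b t i \<omega> * zz t i \<omega>)" for t \<omega>
      unfolding ip_def I_def b_def zz_def est_eq
      by (subst sum.Sigma) (use finite_act in \<open>auto simp: case_prod_beta m_def\<close>)
    have b01: "0 \<le> b t i \<omega> \<and> b t i \<omega> \<le> 1" if "t \<in> {1..T}" "i \<in> I" "\<omega> \<in> space M" for t i \<omega>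
    proof -
      obtain x a where xa: "i = (x, a)" "x \<in> X" "a \<in> act x" using \<open>i \<in> I\<close> by (auto simp: I_def)
      show ?thesis using m0[OF that(1,3) xa(2,3)] g_pos[OF xa(2)] by (simp add: b_def xa(1))
    qed
    have k01: "0 \<le> k t i \<omega> \<and> k t i \<omega> \<le> 1" if "t \<in> {1..T}" "i \<in> I" "\<omega> \<in> space M" for t i \<omega>
    proof -
      obtain x a where xa: "i = (x, a)" "x \<in> X" "a \<in> act x" using \<open>i \<in> I\<close> by (auto simp: I_def)
      have "m t \<omega> x a * ?l t \<omega> x a \<le> 1" unfolding m_def
        using rplan_lossf_le_1[OF tr[OF that(1,3)] pol[OF that(1,3)] xa(2,3)] Rr[OF that(1,3) xa(2,3)] by blast
      then show ?thesis
        using m0[OF that(1,3) xa(2,3)] l0[OF that(1,3) xa(2,3)] by (simp add: k_def xa(1))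
    qed
    have zz01: "0 \<le> zz t i \<omega> \<and> zz t i \<omega> \<le> 1" if "t \<in> {1..T}" "i \<in> I" "\<omega> \<in> space M" for t i \<omega>
      using z1 that by (auto simp: I_def zz_def)
    \<comment> \<open>The range of the martingale differences is governed by \<open>H\<close> and
      not by the number of pairs, because only visited pairs contribute.\<close>
    have Y_le: "(\<Sum>i\<in>I. b t i \<omega> * zz t i \<omega>) \<le> real H" if t: "t \<in> {1..T}" and w: "\<omega> \<in> space M" for t \<omega>
    proof -
      have "(\<Sum>i\<in>I. b t i \<omega> * zz t i \<omega>) = (\<Sum>x\<in>X. \<Sum>a\<in>act x. b t (x, a) \<omega> * z t x a \<omega>)"
        unfolding I_def zz_def by (subst sum.Sigma) (use finite_act in \<open>auto simp: case_prod_beta\<close>)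
      also have "\<dots> \<le> (\<Sum>x\<in>X. \<Sum>a\<in>act x.
          if xobs t (lvl x) \<omega> = x \<and> aobs t (lvl x) \<omega> = a then 1 else 0)"
      proof (intro sum_mono)
        fix x a assume xa: "x \<in> X" "a \<in> act x"
        then have "b t (x, a) \<omega> * z t x a \<omega> \<le> 1 * z t x a \<omega>"
          using b01[OF t _ w] z01[OF t w] by (intro mult_right_mono) (auto simp: I_def)
        then show "b t (x, a) \<omega> * z t x a \<omega>
          \<le> (if xobs t (lvl x) \<omega> = x \<and> aobs t (lvl x) \<omega> = a then 1 else 0)"
          using z01[OF t w xa(1), of a] by linarith
      qed
      also have "\<dots> \<le> real H" using sum_visits_le[of "\<lambda>h. xobs t h \<omega>" "\<lambda>h. aobs t h \<omega>"] .
      finally show ?thesis .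
    qed
    have b_meas: "b t i \<in> borel_measurable (F (t - 1))" and k_meas: "k t i \<in> borel_measurable (F (t - 1))"
      and zz_meas: "zz t i \<in> borel_measurable (F t)"
      and zz_ce: "AE \<omega> in M. real_cond_exp M (F (t - 1)) (zz t i) \<omega> = k t i \<omega>"
      if "t \<in> {1..T}" "i \<in> I" for t i
    proof -
      obtain x a where xa: "i = (x, a)" "x \<in> X" "a \<in> act x" using \<open>i \<in> I\<close> by (auto simp: I_def)
      note ms = m_meas[OF that(1) xa(2,3)] l_meas[OF that(1) xa(2,3)]
      show "b t i \<in> borel_measurable (F (t - 1))" using ms by (simp add: b_def xa(1))
      show "k t i \<in> borel_measurable (F (t - 1))" using ms by (simp add: k_def xa(1))
      show "zz t i \<in> borel_measurable (F t)" using z_meas[OF that(1) xa(2)] by (simp add: zz_def xa(1))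
      show "AE \<omega> in M. real_cond_exp M (F (t - 1)) (zz t i) \<omega> = k t i \<omega>"
        using ce[OF that(1) xa(2,3)] by (simp add: zz_def k_def xa(1))
    qed
    \<comment> \<open>This value minimises \<open>\<iota> / c + c * T * H^2 / 2\<close>: it makes
      the total compensator \<open>T * (c * H)^2 / 2\<close> equal to
      \<open>\<iota>\<close>.\<close>
    define c where "c = sqrt (2 * \<iota> / real T) / real H"
    have c_pos: "0 < c" using iota1 T1 H_pos by (simp add: c_def)
    define U where "U = (\<lambda>t \<omega>. c * ((\<Sum>i\<in>I. b t i \<omega> * k t i \<omega>) - (\<Sum>i\<in>I. b t i \<omega> * zz t i \<omega>))
        - (c * real H)\<^sup>2 / 2)"
    define bad0 where "bad0 = {\<omega> \<in> space M. \<iota> < (\<Sum>t\<in>{1..T}. U t \<omega>)}"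
    have U_meas: "U t \<in> borel_measurable (F t)" if t: "t \<in> {1..T}" for t
      unfolding U_def
      using b_meas[OF t, THEN measurable_from_subalg[OF sub']] zz_meas[OF t]
        k_meas[OF t, THEN measurable_from_subalg[OF sub']]
      by (intro borel_measurable_diff borel_measurable_times borel_measurable_sum borel_measurable_const) auto
    have "(\<lambda>\<omega>. \<Sum>t\<in>{1..T}. U t \<omega>) \<in> borel_measurable M"
      using measurable_from_subalg[OF sub U_meas] by (intro borel_measurable_sum)
    then have bad0_meas: "bad0 \<in> sets M" unfolding bad0_def by simp
    have bad0_prob: "prob bad0 \<le> exp (- \<iota>)"
      unfolding bad0_def
    proof (rule exp_supermartingale_tail[where F = F and B = "c * real (card I)"])
      show "U t \<omega> \<le> c * real (card I)" if t: "t \<in> {1..T}" and w: "\<omega> \<in> space M" for t \<omega>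
      proof -
        have "(\<Sum>i\<in>I. b t i \<omega> * k t i \<omega>) \<le> (\<Sum>i\<in>I. 1 * 1)"
          using b01[OF t _ w] k01[OF t _ w] by (intro sum_mono mult_mono) auto
        moreover have "0 \<le> (\<Sum>i\<in>I. b t i \<omega> * zz t i \<omega>)"
          using b01[OF t _ w] zz01[OF t _ w] by (intro sum_nonneg mult_nonneg_nonneg) auto
        ultimately have "c * ((\<Sum>i\<in>I. b t i \<omega> * k t i \<omega>) - (\<Sum>i\<in>I. b t i \<omega> * zz t i \<omega>)) \<le> c * real (card I)"
          using c_pos by (intro mult_left_mono) auto
        then show ?thesis unfolding U_def using zero_le_power2[of "c * real H"] by linarith
      qed
      fix t and f :: "'w \<Rightarrow> real" and C :: real
      assume t: "t \<in> {1..T}" and f: "f \<in> borel_measurable (F (t - 1))"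
        "\<And>\<omega>. \<omega> \<in> space M \<Longrightarrow> 0 \<le> f \<omega> \<and> f \<omega> \<le> C"
      show "(\<integral>\<omega>. f \<omega> * exp (U t \<omega>) \<partial>M) \<le> (\<integral>\<omega>. f \<omega> \<partial>M)"
        unfolding U_def
        by (rule azuma_step[OF sub finI f(1) b_meas[OF t] k_meas[OF t]
              measurable_from_subalg[OF sub zz_meas[OF t]] f(2) b01[OF t] k01[OF t] zz01[OF t]
              Y_le[OF t] less_imp_le[OF c_pos] zz_ce[OF t]])
    qed (use sub F_mono U_meas in auto)

    \<comment> \<open>The good event\<close>
    define E where "E = space M - (bad0 \<union> (\<Union>i\<in>I. bad i))"
    have bads_meas: "bad i \<in> sets M" and bads_prob: "prob (bad i) \<le> exp (- \<iota>)" if "i \<in> I" for i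
      using bad_meas bad_prob that by (auto simp: I_def)
    have U_bad: "(\<Union>i\<in>I. bad i) \<in> sets M" using bads_meas finI by blast
    have E_meas: "E \<in> sets M" unfolding E_def using bad0_meas U_bad by blast
    have card_I: "real (card I) = ?N"
      unfolding I_def AX_def by (simp add: card_SigmaI finite_act)
    have E_prob: "1 - \<delta> \<le> prob E"
    proof -
      have "prob (bad0 \<union> (\<Union>i\<in>I. bad i)) \<le> prob bad0 + prob (\<Union>i\<in>I. bad i)"
        using bad0_meas U_bad by (rule measure_Un_le)
      also have "prob (\<Union>i\<in>I. bad i) \<le> (\<Sum>i\<in>I. prob (bad i))"
        using bads_meas finI by (intro finite_measure_subadditive_finite) auto
      also have "\<dots> \<le> (\<Sum>i\<in>I. exp (- \<iota>))" using bads_prob by (rule sum_mono)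
      also have "\<dots> = ?N * exp (- \<iota>)" by (simp add: card_I)
      also have "prob bad0 + ?N * exp (- \<iota>) \<le> (1 + ?N) * exp (- \<iota>)"
        \<comment> \<open>There are \<open>?N + 1\<close> bad events of probability at most
          \<open>\<delta> / (3 * ?N)\<close> each, and \<open>?N + 1 \<le> 3 * ?N\<close>.\<close>
        using bad0_prob by (simp add: algebra_simps)
      also have "\<dots> \<le> \<delta>" using delta N2 by (simp add: exp_iota field_simps)
      finally have "prob (bad0 \<union> (\<Union>i\<in>I. bad i)) \<le> \<delta>" by simp
      then show ?thesis
        unfolding E_def using bad0_meas U_bad by (subst prob_compl) auto
    qed

    \<comment> \<open>The regret on the good event\<close>
    have "?reg \<omega> \<mu>' \<le> ?bound" if wE: "\<omega> \<in> E" and mu': "\<mu>' \<in> policies X act" for \<omega> \<mu>'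
    proof -
      have w: "\<omega> \<in> space M" using wE by (simp add: E_def)
      have over: "(\<Sum>t\<in>{1..T}. est t \<omega> x a - ?l t \<omega> x a) \<le> \<iota> / (2 * gam (lvl x)) * ?p x"
        if xa: "x \<in> X" "a \<in> act x" for x a
      proof -
        have "\<omega> \<notin> bad (x, a)" using wE xa by (auto simp: E_def I_def)
        then have "2 * g x * (\<Sum>t\<in>{1..T}. est t \<omega> x a - ?l t \<omega> x a) \<le> \<iota>"
          using w by (simp add: bad_def sum_distrib_left not_less)
        then have "(\<Sum>t\<in>{1..T}. est t \<omega> x a - ?l t \<omega> x a) \<le> \<iota> / (2 * g x)"
          using g_pos[OF xa(1)] by (simp add: field_simps)
        then show ?thesis by (simp add: g_def)
      qed
      have under: "(\<Sum>t\<in>{1..T}. ix_mean gam (mu t \<omega>) (?l t \<omega>) - ip X act par H (mu t \<omega>) (est t \<omega>))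
        \<le> 2 * sqrt \<iota> * sqrt B"
      proof -
        define S where "S = (\<Sum>t\<in>{1..T}. ix_mean gam (mu t \<omega>) (?l t \<omega>) - ip X act par H (mu t \<omega>) (est t \<omega>))"
        have "\<omega> \<notin> bad0" using wE by (simp add: E_def)
        then have "(\<Sum>t\<in>{1..T}. U t \<omega>) \<le> \<iota>" using w by (simp add: bad0_def not_less)
        moreover have "(\<Sum>t\<in>{1..T}. U t \<omega>) = c * S - real T * ((c * real H)\<^sup>2 / 2)"
          unfolding U_def S_def mean_eq ip_eq by (simp add: sum_subtractf flip: sum_distrib_left)
        moreover have "(c * real H)\<^sup>2 = 2 * \<iota> / real T"
          using H_pos iota1 T1 by (simp add: c_def)
        \<comment> \<open>One \<open>\<iota>\<close> is the threshold of \<open>bad0\<close>, the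
          other the total compensator.\<close>
        ultimately have "c * S \<le> 2 * \<iota>" using T1 by simp
        then have "S \<le> 2 * \<iota> / c" using c_pos by (simp add: field_simps)
        also have "\<dots> = real H * sqrt (2 * \<iota> * real T)"
        proof -
          have "sqrt (2 * \<iota> / real T) * sqrt (2 * \<iota> * real T) = sqrt ((2 * \<iota>)\<^sup>2)"
            unfolding real_sqrt_mult[symmetric] using T1 by (simp add: power2_eq_square)
          also have "\<dots> = 2 * \<iota>" using iota1 by (simp only: real_sqrt_abs)
          finally have "c * (real H * sqrt (2 * \<iota> * real T)) = 2 * \<iota>"
            using H_pos iota1 by (simp add: c_def)
          then show ?thesis using c_pos by (simp add: field_simps)
        qed
        \<comment> \<open>The factor \<open>H\<close> of the martingale bound is absorbed through
          \<open>H^2 \<le> 2 * 2 ^ H \<le> 2 * ?N\<close>.\<close>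
        also have "\<dots> \<le> sqrt (2 * ?N) * sqrt (2 * \<iota> * real T)"
        proof (rule mult_right_mono)
          have "(real H)\<^sup>2 \<le> 2 * 2 ^ H"
            using square_le_double_power[of H] of_nat_mono[of "H\<^sup>2" "2 * 2 ^ H", where 'a = real] by simp
          also have "\<dots> \<le> 2 * ?N" using N_pow by simp
          finally show "real H \<le> sqrt (2 * ?N)" by (rule real_le_rsqrt)
        qed (use iota1 in simp)
        also have "\<dots> = sqrt (2\<^sup>2 * (\<iota> * B))"
          unfolding real_sqrt_mult[symmetric] by (simp add: B_def mult_ac)
        also have "\<dots> = 2 * sqrt \<iota> * sqrt B" by (simp add: real_sqrt_mult)
        finally show ?thesis unfolding S_def .
      qed
      have main: "?reg \<omega> \<mu>' \<le> (\<Sum>h\<in>{1..H}. ln ?N / eta h)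
          + real T * (\<Sum>h\<in>{1..H}. eta h / 2 * (?N / real A ^ (H - h)))
          + (\<Sum>x\<in>X. \<Sum>a\<in>act x. eta (lvl x) / 2 * (\<iota> / (2 * gam (lvl x))))
          + (\<Sum>h\<in>{1..H}. \<iota> / (2 * gam h))
          + real T * (\<Sum>h\<in>{1..H}. gam h * (?N / real A ^ (H - h))) + 2 * sqrt \<iota> * sqrt B"
      proof (rule regret_decomposition[OF actA eta_pos gam_pos T1, where est = "\<lambda>t. est t \<omega>"])
        show "mu t \<omega> \<in> policies X act \<and> (\<forall>\<nu>\<in>policies X act.
            ftrl_obj X lvl act par H eta (\<lambda>x a. \<Sum>k\<in>{1..<t}. est k \<omega> x a) (mu t \<omega>)
            \<le> ftrl_obj X lvl act par H eta (\<lambda>x a. \<Sum>k\<in>{1..<t}. est k \<omega> x a) \<nu>)"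
          if "t \<in> {1..T}" for t
          using mu_ftrl that w unfolding est_def by blast
        show "rplan par H (mu t \<omega>) x a * est t \<omega> x a \<le> 1" if "t \<in> {1..T}" "x \<in> X" "a \<in> act x" for t x a
          using mest_le[OF that(1) w that(2,3)] by (simp add: m_def)
      qed (use tr Rr est0 over under mu' w in blast)+
      have S_pos: "0 < real A ^ n" for n using A2 by simp
      \<comment> \<open>Each of \<open>r1\<close> to \<open>r4\<close> contributes 5/2: penalty and
        stability together give \<open>5 * sqrt (ln ?N)\<close>, deviation and bias together
        \<open>5 * sqrt \<iota>\<close>, times \<open>sqrt B\<close>.\<close>
      have r1: "(\<Sum>h\<in>{1..H}. ln ?N / eta h) \<le> 5 / 2 * sqrt (ln ?N) * sqrt B"
        unfolding eta' rate_identities(1)[OF lnN S_pos B]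
        using A2 lnN B by (intro sum_rate_le) auto
      have r2: "real T * (\<Sum>h\<in>{1..H}. eta h / 2 * (?N / real A ^ (H - h))) \<le> 5 / 2 * sqrt (ln ?N) * sqrt B"
      proof -
        have "real T * (\<Sum>h\<in>{1..H}. eta h / 2 * (?N / real A ^ (H - h)))
          = (\<Sum>h\<in>{1..H}. B * (eta h / 2 / real A ^ (H - h)))"
          unfolding sum_distrib_left by (intro sum.cong refl) (simp add: B_def)
        also have "\<dots> \<le> 5 / 2 * sqrt (ln ?N) * sqrt B"
          unfolding eta' rate_identities(2)[OF lnN S_pos B]
          using A2 lnN B by (intro sum_rate_le) auto
        finally show ?thesis .
      qed
      have iota0: "0 < \<iota>" using iota1 by simp
      have r3: "(\<Sum>h\<in>{1..H}. \<iota> / (2 * gam h)) \<le> 5 / 2 * sqrt \<iota> * sqrt B"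
        unfolding gam' rate_identities(3)[OF iota0 S_pos B]
        using A2 iota0 B by (intro sum_rate_le) auto
      have r4: "real T * (\<Sum>h\<in>{1..H}. gam h * (?N / real A ^ (H - h))) \<le> 5 / 2 * sqrt \<iota> * sqrt B"
      proof -
        have "real T * (\<Sum>h\<in>{1..H}. gam h * (?N / real A ^ (H - h)))
          = (\<Sum>h\<in>{1..H}. B * (gam h / real A ^ (H - h)))"
          unfolding sum_distrib_left by (intro sum.cong refl) (simp add: B_def)
        also have "\<dots> \<le> 5 / 2 * sqrt \<iota> * sqrt B"
          unfolding gam' rate_identities(4)[OF iota0 S_pos B]
          using A2 iota0 B by (intro sum_rate_le) auto
        finally show ?thesis .
      qed
      \<comment> \<open>As \<open>ln ?N \<le> \<iota>\<close>, each rate satisfies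
        \<open>eta h \<le> 2 * gam h\<close>, so every pair costs at most
        \<open>\<iota> / 2\<close>. The \<open>?N\<close> pairs fit under \<open>sqrt B\<close>
        because \<open>?N \<le> T\<close>.\<close>
      have r5: "(\<Sum>x\<in>X. \<Sum>a\<in>act x. eta (lvl x) / 2 * (\<iota> / (2 * gam (lvl x)))) \<le> \<iota> / 2 * sqrt B"
      proof -
        have eg: "eta h / 2 * (\<iota> / (2 * gam h)) \<le> \<iota> / 2" for h
        proof -
          have "eta h \<le> sqrt (2\<^sup>2 * (real A ^ (H - h) * \<iota> / (2 * B)))"
            unfolding eta' using iota_lnN B S_pos[of "H - h"]
            by (intro real_sqrt_le_mono) (simp add: field_simps)
          also have "\<dots> = 2 * gam h" by (simp only: gam' real_sqrt_mult real_sqrt_abs)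
          finally have "eta h * \<iota> \<le> 2 * gam h * \<iota>" using iota0 by (intro mult_right_mono) auto
          then show ?thesis using gam_pos[of h] by (simp add: field_simps)
        qed
        have "(\<Sum>x\<in>X. \<Sum>a\<in>act x. eta (lvl x) / 2 * (\<iota> / (2 * gam (lvl x)))) \<le> (\<Sum>x\<in>X. \<Sum>a\<in>act x. \<iota> / 2)"
          by (intro sum_mono eg)
        also have "\<dots> = \<iota> / 2 * ?N" by (simp add: AX_def sum_distrib_left mult.commute)
        also have "\<dots> \<le> \<iota> / 2 * sqrt B"
        proof (rule mult_left_mono)
          have "?N\<^sup>2 \<le> B" unfolding B_def power2_eq_square using NT N2 by (intro mult_left_mono) auto
          then show "?N \<le> sqrt B" by (rule real_le_rsqrt)
        qed (use iota0 in simp)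
        finally show ?thesis .
      qed
      \<comment> \<open>The coefficients of \<open>sqrt \<iota>\<close> are 5 from \<open>r3\<close>
        and \<open>r4\<close> and 2 from \<open>under\<close>; with the \<open>\<iota> / 2\<close>
        of \<open>r5\<close> they total at most \<open>15/2 * \<iota>\<close>, below
        \<open>8 * \<iota>\<close>.\<close>
      have "sqrt \<iota> \<le> \<iota>"
        using iota1 by (intro real_le_lsqrt) (auto simp: power2_eq_square)
      then have "sqrt \<iota> * sqrt B \<le> \<iota> * sqrt B" using B by (intro mult_right_mono) auto
      moreover have "0 \<le> sqrt (ln ?N) * sqrt B" "0 \<le> \<iota> * sqrt B" using lnN B iota0 by auto
      ultimately have "?reg \<omega> \<mu>' \<le> 5 * (sqrt (ln ?N) * sqrt B) + 8 * (\<iota> * sqrt B)"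
        using main r1 r2 r3 r4 r5 by linarith
      then show ?thesis by (simp add: B_def algebra_simps)
    qed
    then show ?thesis
      using policies_nonempty E_meas E_prob by (intro bexI[of _ E]) (auto intro!: cSUP_least)
  qed
qed

end
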